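(* Let $\phi$ be a set of $m$ UTVPI constraints on $n$ variables that is satisfiable over $\mathbb{Z}$. Let $\pi$ be a valid potential function for $G_\phi$, and let $\rho$ be the bounds function of $\phi$. Let $P$ be a set of $p$ UTVPI constraints none of which is implied by $\phi$, and let $c$ be a UTVPI constraint. Then Algorithm ScSt, run on $(G_\phi,\pi,\rho,P,c)$, has the following output: - if $\phi\cup\{c\}$ is unsatisfiable over $\mathbb{Z}$, it returns UNSAT; - otherwise it returns $G_{\phi\cup\{c\}}$, a valid potential function $\pi'$ for it, the bounds function $\rho'$ of $\phi\cup\{c\}$, and $P'=\{c'\in P\mid \phi\cup\{c\}\not\models c'\}$. Moreover, it runs in $O(n\log n+m+p)$ time and $O(n+m+p)$ space.
   Context: **Constraints and graphs.** A UTVPI constraint is $ax+by\le d$ with integer variables $x,y$, $a,b\in\{-1,0,1\}$ and $d\in\mathbb{Z}$ (with at least one nonzero coefficient). For a UTVPI constraint $c$, the edge set $E(c)$ (edges $u\xrightarrow{d}v$ of weight $d$, over vertices $x^+,x^-$ per variable) is: - $x-y\le d$: $\{y^+\xrightarrow{d}x^+,\ x^-\xrightarrow{d}y^-\}$; - $x+y\le d$: $\{y^-\xrightarrow{d}x^+,\ x^-\xrightarrow{d}y^+\}$; - $-x-y\le d$: $\{y^+\xrightarrow{d}x^-,\ x^+\xrightarrow{d}y^-\}$; - $x\le d$: $\{x^-\xrightarrow{2d}x^+\}$; - $-x\le d$: $\{x^+\xrightarrow{2d}x^-\}$. The constraint graph $G_\phi$ has vertex set $V=\{x^+,x^-\mid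 x \text{ a variable}\}$ and edge set $\bigcup_{c\in\phi}E(c)$. Write $-x^+:=x^-$ and $-x^-:=x^+$. **Paths, potentials, bounds.** For a graph without negative weight cycles, $wSP(u,v)$ is the minimum path weight from $u$ to $v$, or $+\infty$ if no path exists. Define $\delta^\leftarrow_u(x)=wSP(x,u)$ and $\delta^\rightarrow_v(x)=wSP(v,x)$. A valid potential function for such a graph is $\pi:V\to\mathbb{R}$ with $\pi(u)+d-\pi(v)\ge0$ for every edge $u\xrightarrow{d}v$. The reduced cost graph replaces each such weight $d$ by $\pi(u)+d-\pi(v)$. The bounds function of $\phi$ is $\rho(u)=\lfloor wSP(u,-u)/2\rfloor$, computed in $G_\phi$. **Subroutine IncConDiff** (the incremental negative cycle detection of Cotton–Maler/Frigioni et al.). Given a graph $G$ with valid potential $\pi$ and a new edge $e$, it returns UNSAT if $G+e$ has a negative weight cycle. Otherwise it returns $G+e$ together with a valid potential for it. It runs in $O(n\log n+m)$ time and $O(n+m)$ space. **Algorithm ScSt** on input $(G_\phi,\pi,\rho,P,c)$: 1. Set $G':=G_\phi$, $\pi':=\pi$. For each $e\in E(c)$, run IncConDiff$(G',\pi',e)$. If it returns UNSAT, return UNSAT; otherwise update $(G',\pi')$ to its output. 2. Let $(u,v,d)$ be any edge of $E(c)$. Compute $\delta^\leftarrow_u$ and $\delta^\rightarrow_v$ in $G'$ using Dijkstra's algorithm on the reduced cost graph of $G'$ with respect to $\pi'$. 3. For every $x\in V$, set $\rho'(x):=\min\{\rho(x),\lfloor(\delta^\leftarrow_u(x)+d+\delta^\rightarrow_v(-x))/2\rfloor\}$.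 4. If some $x\in V$ has $\rho'(x)+\rho'(-x)<0$, return UNSAT. 5. Set $P':=\emptyset$. For each $c'\in P$, let $(x,y,d')$ be the first element of $E(c')$. Add $c'$ to $P'$ if all three of the following hold: $\delta^\leftarrow_u(x)+d+\delta^\rightarrow_v(y)>d'$, $\delta^\leftarrow_u(-y)+d+\delta^\rightarrow_v(-x)>d'$, and $\rho'(x)+\rho'(-y)>d'$. 6. Return $(G',\pi',\rho',P')$. *)

theory Defs
  imports "HOL-Library.Extended_Real" "HOL-Library.Log_Nat" "HOL-Library.Monad_Syntax"
begin

section \<open>UTVPI constraints\<close>

text \<open>
  The constructors are the five forms of a nonzero left-hand side
  \<open>a x + b y\<close> with \<open>a, b \<in> {-1, 0, 1}\<close>; the form \<open>- x + y \<le> d\<close> is \<open>Diff y x d\<close>.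
  The two variables of a constraint are allowed to coincide.
\<close>

datatype 'v utvpi =
    Diff 'v 'v int    \<comment> \<open>\<open>x - y \<le> d\<close>\<close>
  | Sum 'v 'v int     \<comment> \<open>\<open>x + y \<le> d\<close>\<close>
  | NegSum 'v 'v int  \<comment> \<open>\<open>- x - y \<le> d\<close>\<close>
  | Upper 'v int      \<comment> \<open>\<open>x \<le> d\<close>\<close>
  | Lower 'v int      \<comment> \<open>\<open>- x \<le> d\<close>\<close>

primrec holds :: "('v \<Rightarrow> int) \<Rightarrow> 'v utvpi \<Rightarrow> bool" where
  "holds \<sigma> (Diff x y d) \<longleftrightarrow> \<sigma> x - \<sigma> y \<le> d"
| "holds \<sigma> (Sum x y d) \<longleftrightarrow> \<sigma> x + \<sigma> y \<le> d"
| "holds \<sigma> (NegSum x y d) \<longleftrightarrow> - \<sigma> x - \<sigma> y \<le> d"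
| "holds \<sigma> (Upper x d) \<longleftrightarrow> \<sigma> x \<le> d"
| "holds \<sigma> (Lower x d) \<longleftrightarrow> - \<sigma> x \<le> d"

abbreviation vars :: "'v utvpi \<Rightarrow> 'v set" where
  "vars \<equiv> set_utvpi"

definition satisfiable :: "'v utvpi set \<Rightarrow> bool" where
  "satisfiable \<phi> \<longleftrightarrow> (\<exists>\<sigma>. \<forall>c\<in>\<phi>. holds \<sigma> c)"

definition entails :: "'v utvpi set \<Rightarrow> 'v utvpi \<Rightarrow> bool" where
  "entails \<phi> c \<longleftrightarrow> (\<forall>\<sigma>. (\<forall>c'\<in>\<phi>. holds \<sigma> c') \<longrightarrow> holds \<sigma> c)"


section \<open>Weighted graphs\<close>

text \<open>An edge \<open>(u, v, d)\<close> leads from \<open>u\<close> to \<open>v\<close> and has weight \<open>d\<close>.\<close>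

type_synonym 'a edge = "'a \<times> 'a \<times> real"

fun walk :: "'a edge set \<Rightarrow> 'a \<Rightarrow> 'a edge list \<Rightarrow> 'a \<Rightarrow> bool" where
  "walk E u [] v \<longleftrightarrow> u = v"
| "walk E u ((a, b, d) # p) v \<longleftrightarrow> (a, b, d) \<in> E \<and> a = u \<and> walk E b p v"

definition weight :: "'a edge list \<Rightarrow> real" where
  "weight p = (\<Sum>(a, b, d)\<leftarrow>p. d)"

definition neg_cycle :: "'a edge set \<Rightarrow> bool" where
  "neg_cycle E \<longleftrightarrow> (\<exists>u p. walk E u p u \<and> weight p < 0)"

text \<open>
  In a finite graph without negative cycles the infimum is attained whenever there is
  a walk from \<open>u\<close> to \<open>v\<close>; it is \<open>\<infinity>\<close> if there is none.
\<close>

definition wSP :: "'a edge set \<Rightarrow> 'a \<Rightarrow> 'a \<Rightarrow> ereal" where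
  "wSP E u v = (INF p\<in>{p. walk E u p v}. ereal (weight p))"

definition valid_potential :: "'a edge set \<Rightarrow> ('a \<Rightarrow> real) \<Rightarrow> bool" where
  "valid_potential E \<pi> \<longleftrightarrow> (\<forall>(u, v, d)\<in>E. \<pi> u + d - \<pi> v \<ge> 0)"


section \<open>Constraint graphs and bounds\<close>

datatype 'v vertex = Pos 'v | Neg 'v

primrec opp :: "'v vertex \<Rightarrow> 'v vertex" where
  "opp (Pos x) = Neg x"
| "opp (Neg x) = Pos x"

definition vertices :: "'v set \<Rightarrow> 'v vertex set" where
  "vertices X = Pos ` X \<union> Neg ` X"

primrec edges_of :: "'v utvpi \<Rightarrow> 'v vertex edge list" where
  "edges_of (Diff x y d) = [(Pos y, Pos x, of_int d), (Neg x, Neg y, of_int d)]"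
| "edges_of (Sum x y d) = [(Neg y, Pos x, of_int d), (Neg x, Pos y, of_int d)]"
| "edges_of (NegSum x y d) = [(Pos y, Neg x, of_int d), (Pos x, Neg y, of_int d)]"
| "edges_of (Upper x d) = [(Neg x, Pos x, 2 * of_int d)]"
| "edges_of (Lower x d) = [(Pos x, Neg x, 2 * of_int d)]"

definition constraint_graph :: "'v utvpi set \<Rightarrow> 'v vertex edge set" where
  "constraint_graph \<phi> = (\<Union>c\<in>\<phi>. set (edges_of c))"

definition efloor :: "ereal \<Rightarrow> ereal" where
  "efloor x = (if \<bar>x\<bar> = \<infinity> then x else ereal (of_int \<lfloor>real_of_ereal x\<rfloor>))"

definition bounds :: "'v utvpi set \<Rightarrow> 'v vertex \<Rightarrow> ereal" where
  "bounds \<phi> u = efloor (wSP (constraint_graph \<phi>) u (opp u) / 2)"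


section \<open>Computations with cost\<close>

text \<open>
  A computation yields a result, the number of elementary steps it performs, and the number
  of memory cells it allocates. Memory is never reclaimed, so the second count bounds
  the memory in use at any time. The machine is a random access machine: arithmetic,
  comparisons and array accesses take unit time, and cells hold vertices, numbers and pointers.
  Arrays indexed by vertices are modelled by functions; they are used single-threadedly, so
  that a function update stands for an assignment.
\<close>

datatype 'a cost = Cost (result: 'a) (time: nat) (space: nat)

definition bind_cost :: "'a cost \<Rightarrow> ('a \<Rightarrow> 'b cost) \<Rightarrow> 'b cost" where
  "bind_cost m f = (let r = f (result m) in
     Cost (result r) (time m + time r) (space m + space r))"

adhoc_overloading Monad_Syntax.bind \<rightleftharpoons> bind_cost

definition return :: "'a \<Rightarrow> 'a cost" where
  "return x = Cost x 1 0"

definition tick :: "nat \<Rightarrow> unit cost" where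
  "tick k = Cost () k 0"

definition alloc :: "nat \<Rightarrow> unit cost" where
  "alloc k = Cost () 0 k"

text \<open>
  Each iteration is charged one step, plus whatever its body is charged.
\<close>

fun for_each :: "'b list \<Rightarrow> ('b \<Rightarrow> 's \<Rightarrow> 's cost) \<Rightarrow> 's \<Rightarrow> 's cost" where
  "for_each [] f s = return s"
| "for_each (x # xs) f s = do { tick 1; s' \<leftarrow> f x s; for_each xs f s' }"

definition new_array :: "'a list \<Rightarrow> 'b \<Rightarrow> ('a \<Rightarrow> 'b) cost" where
  "new_array V b = do { tick (length V); alloc (length V); return (\<lambda>_. b) }"

definition tabulate :: "'a list \<Rightarrow> ('a \<Rightarrow> ereal) \<Rightarrow> ('a \<Rightarrow> ereal) cost" where
  "tabulate V f = do {
     A \<leftarrow> new_array V \<infinity>;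
     for_each V (\<lambda>x A. return (A(x := f x))) A
   }"


section \<open>Dijkstra's algorithm\<close>

text \<open>
  A graph is stored as the list of its vertices and the list of its edges.
\<close>

type_synonym 'a graph = "'a list \<times> 'a edge list"

definition represents :: "'a graph \<Rightarrow> 'a set \<Rightarrow> 'a edge set \<Rightarrow> bool" where
  "represents G V E \<longleftrightarrow>
     distinct (fst G) \<and> set (fst G) = V \<and>
     distinct (snd G) \<and> set (snd G) = E \<and> E \<subseteq> V \<times> V \<times> UNIV"

definition adjacency :: "'a graph \<Rightarrow> ('a \<Rightarrow> ('a \<times> real) list) cost" where
  "adjacency G = do {
     A \<leftarrow> new_array (fst G) [];
     for_each (snd G) (\<lambda>(a, b, w) A. do { alloc 1; return (A(a := (b, w) # A a)) }) A
   }"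

text \<open>
  The set \<open>Q\<close> is the content of a priority queue in which the key of a vertex \<open>b\<close> is \<open>D b\<close>.
  Its operations are charged the amortized costs of a Fibonacci heap, whose sum over all
  operations bounds the actual cost of a run that starts with an empty heap: constant
  time and space for each of the initial insertions, \<open>1 + log |Q|\<close> for extracting a minimum,
  and constant time for decreasing a key.
\<close>

definition dijkstra :: "'a graph \<Rightarrow> 'a \<Rightarrow> ('a \<Rightarrow> ereal) cost" where
  "dijkstra G s = do {
     adj \<leftarrow> adjacency G;
     D \<leftarrow> new_array (fst G) \<infinity>;
     tick (length (fst G));
     alloc (length (fst G));
     (D, Q) \<leftarrow> for_each [0..<length (fst G)] (\<lambda>_ (D, Q). do {
         tick (1 + ceillog2 (card Q));
         let a = arg_min_on D Q;
         D' \<leftarrow> for_each (adj a) (\<lambda>(b, w) D.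
           return (if D a + ereal w < D b then D(b := D a + ereal w) else D)) D;
         return (D', Q - {a})
       }) (D(s := 0), set (fst G));
     return D
   }"

definition reduced :: "('a \<Rightarrow> real) \<Rightarrow> 'a graph \<Rightarrow> 'a graph cost" where
  "reduced \<pi> G = do {
     E \<leftarrow> for_each (snd G)
       (\<lambda>(a, b, w) E. do { alloc 1; return ((a, b, \<pi> a + w - \<pi> b) # E) }) [];
     return (fst G, E)
   }"

definition reversed :: "'a graph \<Rightarrow> 'a graph cost" where
  "reversed G = do {
     E \<leftarrow> for_each (snd G) (\<lambda>(a, b, w) E. do { alloc 1; return ((b, a, w) # E) }) [];
     return (fst G, E)
   }"

text \<open>
  Distances from \<open>v\<close> and to \<open>u\<close>. A walk from \<open>x\<close> to \<open>y\<close> of weight \<open>w\<close> has weight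
  \<open>\<pi> x + w - \<pi> y\<close> in the reduced cost graph.
\<close>

definition dist_from :: "'a graph \<Rightarrow> ('a \<Rightarrow> real) \<Rightarrow> 'a \<Rightarrow> ('a \<Rightarrow> ereal) cost" where
  "dist_from G \<pi> v = do {
     R \<leftarrow> reduced \<pi> G;
     D \<leftarrow> dijkstra R v;
     tabulate (fst G) (\<lambda>x. D x + ereal (\<pi> x - \<pi> v))
   }"

definition dist_to :: "'a graph \<Rightarrow> ('a \<Rightarrow> real) \<Rightarrow> 'a \<Rightarrow> ('a \<Rightarrow> ereal) cost" where
  "dist_to G \<pi> u = do {
     R \<leftarrow> reduced \<pi> G;
     R' \<leftarrow> reversed R;
     D \<leftarrow> dijkstra R' u;
     tabulate (fst G) (\<lambda>x. D x + ereal (\<pi> u - \<pi> x))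
   }"


section \<open>Incremental negative cycle detection\<close>

datatype 'a answer = UNSAT | Answer 'a

type_synonym 'a inc_alg =
  "'a graph \<Rightarrow> ('a \<Rightarrow> real) \<Rightarrow> 'a edge \<Rightarrow> ('a graph \<times> ('a \<Rightarrow> real)) answer cost"

text \<open>
  The specification of the subroutine. The summand \<open>1\<close> in the cost bounds only matters for
  graphs with at most one vertex, where \<open>n log n + m\<close> may vanish.
\<close>

definition inc_con_diff :: "'a inc_alg \<Rightarrow> bool" where
  "inc_con_diff inc \<longleftrightarrow> (\<exists>K::real. \<forall>G V E \<pi> u v d.
     represents G V E \<and> valid_potential E \<pi> \<and> u \<in> V \<and> v \<in> V \<longrightarrow>
       (let r = inc G \<pi> (u, v, d); E' = insert (u, v, d) E;
            n = real (card V); m = real (card E)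
        in (neg_cycle E' \<longrightarrow> result r = UNSAT) \<and>
           (\<not> neg_cycle E' \<longrightarrow> (\<exists>G' \<pi>'. result r = Answer (G', \<pi>') \<and>
              represents G' V E' \<and> valid_potential E' \<pi>')) \<and>
           time r \<le> K * (n * log 2 n + m + 1) \<and>
           space r \<le> K * (n + m + 1)))"


section \<open>The algorithm\<close>

fun add_edges :: "'a inc_alg \<Rightarrow> 'a edge list \<Rightarrow> 'a graph \<Rightarrow> ('a \<Rightarrow> real) \<Rightarrow>
    ('a graph \<times> ('a \<Rightarrow> real)) answer cost" where
  "add_edges inc [] G \<pi> = return (Answer (G, \<pi>))"
| "add_edges inc (e # es) G \<pi> = do {
     tick 1;
     r \<leftarrow> inc G \<pi> e;
     (case r of
        UNSAT \<Rightarrow> return UNSAT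
      | Answer (G', \<pi>') \<Rightarrow> add_edges inc es G' \<pi>')
   }"

text \<open>
  The arguments \<open>order\<close> and \<open>pick\<close> resolve the nondeterminism of the algorithm: the order in
  which the edges of \<open>c\<close> are added, and the edge of \<open>c\<close> from which the distances are computed.
  The initial allocation accounts for the input: the vertices, \<open>\<pi>\<close>, \<open>\<rho>\<close>,
  the edges and the constraints in \<open>P\<close>.
\<close>

definition scst :: "'v vertex inc_alg \<Rightarrow>
    ('v utvpi \<Rightarrow> 'v vertex edge list) \<Rightarrow> ('v utvpi \<Rightarrow> 'v vertex edge) \<Rightarrow>
    'v vertex graph \<Rightarrow> ('v vertex \<Rightarrow> real) \<Rightarrow> ('v vertex \<Rightarrow> ereal) \<Rightarrow>
    'v utvpi list \<Rightarrow> 'v utvpi \<Rightarrow>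
    ('v vertex graph \<times> ('v vertex \<Rightarrow> real) \<times> ('v vertex \<Rightarrow> ereal) \<times> 'v utvpi list) answer cost"
  where
  "scst inc order pick G \<pi> \<rho> P c = do {
     alloc (3 * length (fst G) + length (snd G) + length P);
     r \<leftarrow> add_edges inc (order c) G \<pi>;
     (case r of
        UNSAT \<Rightarrow> return UNSAT
      | Answer (G', \<pi>') \<Rightarrow> do {
          let (u, v, d) = pick c;
          \<delta>to \<leftarrow> dist_to G' \<pi>' u;
          \<delta>from \<leftarrow> dist_from G' \<pi>' v;
          \<rho>' \<leftarrow> tabulate (fst G')
            (\<lambda>x. min (\<rho> x) (efloor ((\<delta>to x + ereal d + \<delta>from (opp x)) / 2)));
          conflict \<leftarrow> for_each (fst G')
            (\<lambda>x b. return (b \<or> \<rho>' x + \<rho>' (opp x) < 0)) False;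
          if conflict then return UNSAT
          else do {
            P' \<leftarrow> for_each P (\<lambda>c' P'.
              let (x, y, d') = hd (edges_of c') in
              if \<delta>to x + ereal d + \<delta>from y > ereal d' \<and>
                 \<delta>to (opp y) + ereal d + \<delta>from (opp x) > ereal d' \<and>
                 \<rho>' x + \<rho>' (opp y) > ereal d'
              then do { alloc 1; return (c' # P') }
              else return P') [];
            return (Answer (G', \<pi>', \<rho>', P'))
          }
        })
   }"

end

theory Submission
  imports Defs
begin

text \<open>
  A UTVPI constraint with edge \<open>(u, v, d)\<close> says that \<open>lit \<sigma> v - lit \<sigma> u \<le> d\<close>, where
  \<open>lit \<sigma>\<close> gives \<open>x\<^sup>+\<close> the value of \<open>x\<close> and \<open>x\<^sup>-\<close> its negative. Closing the path weights
  under the integer bounds \<open>lit \<sigma> v - lit \<sigma> u \<le> \<rho> u + \<rho> (opp v)\<close> yields a system in which every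
  partial integer solution extends to one more variable: all the bounds on the new variable are
  integers, and the lower ones do not exceed the upper ones. Hence a set of constraints with a
  valid potential is satisfiable iff \<open>\<rho> u + \<rho> (opp u) \<ge> 0\<close> for all \<open>u\<close>, and it entails a constraint
  iff one of the two kinds of bounds implies it.

  A new path in the graph of \<open>insert c \<phi>\<close> passes through one of the two edges of \<open>c\<close>. As reversing
  a path and negating its vertices preserves its weight, the distances to and from a single edge
  of \<open>c\<close> determine all new distances.
\<close>

section \<open>Solutions of tightly closed systems\<close>

text \<open>Absence of negative cycles only guarantees a solution over the reals. Integrality enters
  through walks from a vertex to its opposite: there
  \<open>lit \<sigma> (opp u) - lit \<sigma> u\<close> is even, so an odd weight may be lowered by
  one. The obstacle is that rounding could enable further rounding. One round suffices for two
  reasons. A walk from \<open>u\<close> to \<open>v\<close>, followed by a bound on \<open>v\<close>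
  and the mirrored walk back, counts the weight of the walk twice, so rounding before or after makes
  no difference. Distances and bounds may be infinite. The closure argument therefore works with
  upward closed predicates on integers, and extended reals return only when these are compared with
  the quantities that the algorithm computes.\<close>

primrec lit :: "('v \<Rightarrow> int) \<Rightarrow> 'v vertex \<Rightarrow> int" where
  "lit \<sigma> (Pos x) = \<sigma> x"
| "lit \<sigma> (Neg x) = - \<sigma> x"

primrec var_of :: "'v vertex \<Rightarrow> 'v" where
  "var_of (Pos x) = x"
| "var_of (Neg x) = x"

lemma opp_opp [simp]: "opp (opp u) = u"
  by (cases u) auto

lemma lit_opp [simp]: "lit \<sigma> (opp u) = - lit \<sigma> u"
  by (cases u) auto

lemma var_of_opp [simp]: "var_of (opp u) = var_of u"
  by (cases u) auto

lemma opp_neq [simp]: "opp u \<noteq> u" "u \<noteq> opp u"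
  by (cases u; auto)+

lemma mem_vertices: "u \<in> vertices S \<longleftrightarrow> var_of u \<in> S"
  by (cases u) (auto simp: vertices_def)

lemma finite_vertices: "finite S \<Longrightarrow> finite (vertices S)"
  by (simp add: vertices_def)

lemma same_var: "var_of u = var_of v \<Longrightarrow> u = v \<or> u = opp v"
  by (cases u; cases v) auto

lemma lit_cong: "\<tau> (var_of u) = \<sigma> (var_of u) \<Longrightarrow> lit \<tau> u = lit \<sigma> u"
  by (cases u) auto

text \<open>Either set may be empty, and \<open>Inf\<close> and \<open>Sup\<close> are specified
  only for nonempty sets. So \<open>Sup B\<close> serves when \<open>B\<close> has elements and
  \<open>Inf A\<close> otherwise; if both are empty, every value will do.\<close>

lemma int_between:
  fixes A B :: "int set"
  assumes "bdd_below A" "bdd_above B" and le: "\<And>a b. a \<in> A \<Longrightarrow> b \<in> B \<Longrightarrow> b \<le> a"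
  obtains k where "\<And>a. a \<in> A \<Longrightarrow> k \<le> a" "\<And>b. b \<in> B \<Longrightarrow> b \<le> k"
proof (cases "B = {}")
  case True
  then show ?thesis using that[of "Inf A"] assms(1) by (simp add: cInf_lower)
next
  case False
  then show ?thesis using that[of "Sup B"] assms by (simp add: cSup_upper cSup_least)
qed

text \<open>
  \<open>R u v i\<close> says that \<open>lit \<sigma> v - lit \<sigma> u \<le> i\<close> has been derived. The point of
  \<open>tight\<close> and \<open>strong\<close> is that Fourier--Motzkin elimination of a variable only produces
  integer bounds, so that an integer solution can be built one variable at a time.
\<close>

locale tight_system =
  fixes R :: "'v vertex \<Rightarrow> 'v vertex \<Rightarrow> int \<Rightarrow> bool"
  assumes mono: "R u v i \<Longrightarrow> i \<le> j \<Longrightarrow> R u v j"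
    and trans: "R u v i \<Longrightarrow> R v w j \<Longrightarrow> R u w (i + j)"
    and sym: "R u v i \<Longrightarrow> R (opp v) (opp u) i"
    and refl: "R u u i \<longleftrightarrow> 0 \<le> i"
    and tight: "R u (opp u) i \<Longrightarrow> R u (opp u) (2 * (i div 2))"
    and strong: "R u (opp u) (2 * j) \<Longrightarrow> R (opp v) v (2 * k) \<Longrightarrow> R u v (j + k)"
    and bounded: "\<exists>l. \<forall>i. R u v i \<longrightarrow> l \<le> i"
begin

definition sat_on :: "'v set \<Rightarrow> ('v \<Rightarrow> int) \<Rightarrow> bool" where
  "sat_on S \<sigma> \<longleftrightarrow> (\<forall>u\<in>vertices S. \<forall>v\<in>vertices S. \<forall>i. R u v i \<longrightarrow> lit \<sigma> v - lit \<sigma> u \<le> i)"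

lemma sat_onD:
  "sat_on S \<sigma> \<Longrightarrow> R u v i \<Longrightarrow> var_of u \<in> S \<Longrightarrow> var_of v \<in> S \<Longrightarrow> lit \<sigma> v - lit \<sigma> u \<le> i"
  by (auto simp: sat_on_def mem_vertices)

lemma bdd_below_R:
  assumes "\<And>i j. i \<le> j \<Longrightarrow> f i \<le> (f j :: int)"
  shows "bdd_below {f i |i. R u v i}" "bdd_below {f i |i. R u v (2 * i)}"
proof -
  obtain l where l: "\<forall>i. R u v i \<longrightarrow> l \<le> i" using bounded by blast
  show "bdd_below {f i |i. R u v i}"
    by (rule bdd_belowI[of _ "f l"]) (use l assms in auto)
  show "bdd_below {f i |i. R u v (2 * i)}"
    by (rule bdd_belowI[of _ "f (l div 2)"]) (use l assms in fastforce)
qed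

lemma bdd_above_R:
  assumes "\<And>i j. i \<le> j \<Longrightarrow> f j \<le> (f i :: int)"
  shows "bdd_above {f i |i. R u v i}" "bdd_above {f i |i. R u v (2 * i)}"
proof -
  obtain l where l: "\<forall>i. R u v i \<longrightarrow> l \<le> i" using bounded by blast
  show "bdd_above {f i |i. R u v i}"
    by (rule bdd_aboveI[of _ "f l"]) (use l assms in auto)
  show "bdd_above {f i |i. R u v (2 * i)}"
    by (rule bdd_aboveI[of _ "f (l div 2)"]) (use l assms in fastforce)
qed

text \<open>One step of Fourier--Motzkin elimination, run backwards. The sets \<open>A\<close> and
  \<open>B\<close> are additional upper and lower limits on the new literal chosen by the caller,
  and the hypotheses on them exclude conflicts with each other and with the derived bounds. They
  serve to build solutions that violate a bound which is not derivable.\<close>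

lemma extend:
  assumes fin: "finite S" and sat: "sat_on S \<sigma>" and x: "var_of x \<notin> S"
    and A: "bdd_below A" and B: "bdd_above B"
    and BA: "\<And>a b. a \<in> A \<Longrightarrow> b \<in> B \<Longrightarrow> b \<le> a"
    and A1: "\<And>a j. a \<in> A \<Longrightarrow> R x (opp x) (2 * j) \<Longrightarrow> - j \<le> a"
    and A2: "\<And>a u i. a \<in> A \<Longrightarrow> u \<in> vertices S \<Longrightarrow> R x u i \<Longrightarrow> lit \<sigma> u - i \<le> a"
    and B1: "\<And>b j. b \<in> B \<Longrightarrow> R (opp x) x (2 * j) \<Longrightarrow> b \<le> j"
    and B2: "\<And>b u i. b \<in> B \<Longrightarrow> u \<in> vertices S \<Longrightarrow> R u x i \<Longrightarrow> b \<le> lit \<sigma> u + i"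
  obtains \<tau> where "sat_on (insert (var_of x) S) \<tau>" "\<And>y. y \<noteq> var_of x \<Longrightarrow> \<tau> y = \<sigma> y"
    "\<And>a. a \<in> A \<Longrightarrow> lit \<tau> x \<le> a" "\<And>b. b \<in> B \<Longrightarrow> b \<le> lit \<tau> x"
proof -
  \<comment> \<open>All upper and lower limits for \<open>lit \<tau> x\<close>: imposed by the
    caller, by the variable alone, and by the variables already valued. A bound on the variable
    alone is halved; \<open>tight\<close> permits keeping only the even ones.\<close>
  define U where "U = A \<union> {j. R (opp x) x (2 * j)} \<union> (\<Union>u\<in>vertices S. {lit \<sigma> u + i |i. R u x i})"
  define L where "L = B \<union> {- j |j. R x (opp x) (2 * j)} \<union> (\<Union>u\<in>vertices S. {lit \<sigma> u - i |i. R x u i})"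
  have U: "bdd_below U"
    unfolding U_def using A bdd_below_R(2)[where f="\<lambda>j. j"] fin
    by (auto simp: finite_vertices intro!: bdd_below_R)
  have L: "bdd_above L"
    unfolding L_def using B fin
    by (auto simp: finite_vertices intro!: bdd_above_R)
  \<comment> \<open>The derivation from \<open>u\<close> through \<open>x\<close> and
    \<open>opp x\<close> to \<open>opp u\<close> uses the bound on \<open>x\<close> relative to
    \<open>u\<close> and its mirror image. Its total is even, so halving the resulting bound on
    \<open>u\<close> loses nothing.\<close>
  have up: "- j \<le> lit \<sigma> u + i" if "u \<in> vertices S" "R u x i" "R x (opp x) (2 * j)" for u i j
  proof -
    have "R u (opp u) (i + (2 * j + i))" using that by (blast intro: trans sym)
    then have "lit \<sigma> (opp u) - lit \<sigma> u \<le> i + (2 * j + i)"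
      using sat that(1) by (intro sat_onD) (auto simp: mem_vertices)
    then show ?thesis by simp
  qed
  have low: "lit \<sigma> u - i \<le> j" if "u \<in> vertices S" "R x u i" "R (opp x) x (2 * j)" for u i j
  proof -
    have "R (opp u) u (i + (2 * j + i))" using that by (blast intro: trans sym)
    then have "lit \<sigma> u - lit \<sigma> (opp u) \<le> i + (2 * j + i)"
      using sat that(1) by (intro sat_onD) (auto simp: mem_vertices)
    then show ?thesis by simp
  qed
  have both: "lit \<sigma> u - i \<le> lit \<sigma> v + j" if "u \<in> vertices S" "v \<in> vertices S" "R x u i" "R v x j" for u v i j
    using sat_onD[OF sat trans[OF that(4,3)]] that(1,2) by (simp add: mem_vertices)
  have self: "- i \<le> j" if "R x (opp x) (2 * i)" "R (opp x) x (2 * j)" for i j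
    using trans[OF that] by (simp add: refl)
  have "b \<le> a" if "a \<in> U" "b \<in> L" for a b
    using that unfolding U_def L_def
    by (auto intro: BA A1 A2 B1 B2 up low both self)
  with U L obtain k where kU: "\<And>a. a \<in> U \<Longrightarrow> k \<le> a" and kL: "\<And>b. b \<in> L \<Longrightarrow> b \<le> k"
    by (rule int_between) blast+
  \<comment> \<open>The sign change for \<open>Neg\<close> makes \<open>lit \<tau> x\<close> equal
    to \<open>k\<close> in both cases, so \<open>x\<close> may be either vertex of the new
    variable.\<close>
  define \<tau> where "\<tau> = \<sigma>(var_of x := (case x of Pos _ \<Rightarrow> k | Neg _ \<Rightarrow> - k))"
  have \<tau>x: "lit \<tau> x = k" by (cases x) (auto simp: \<tau>_def)
  have \<tau>S: "lit \<tau> u = lit \<sigma> u" if "var_of u \<in> S" for u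
    using that x by (intro lit_cong) (auto simp: \<tau>_def)
  have upx: "k - lit \<tau> u \<le> i" if "R u x i" "var_of u \<in> S" for u i
  proof -
    have "lit \<sigma> u + i \<in> U" using that by (auto simp: U_def mem_vertices)
    then show ?thesis using kU that by (fastforce simp: \<tau>S)
  qed
  have lowx: "lit \<tau> u - k \<le> i" if "R x u i" "var_of u \<in> S" for u i
  proof -
    have "lit \<sigma> u - i \<in> L" using that by (auto simp: L_def mem_vertices)
    then show ?thesis using kL that by (fastforce simp: \<tau>S)
  qed
  have ux: "k + k \<le> i" if "R (opp x) x i" for i
  proof -
    have "R (opp x) x (2 * (i div 2))" using tight[of "opp x" i] that by simp
    then have "k \<le> i div 2" by (intro kU) (auto simp: U_def)
    then show ?thesis by linarith
  qed
  have lx: "- k - k \<le> i" if "R x (opp x) i" for i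
  proof -
    have "R x (opp x) (2 * (i div 2))" using tight[of x i] that by simp
    then have "- (i div 2) \<le> k" by (intro kL) (auto simp: L_def)
    then show ?thesis by linarith
  qed
  have "lit \<tau> v - lit \<tau> u \<le> i"
    if uv: "var_of u \<in> insert (var_of x) S" "var_of v \<in> insert (var_of x) S" and R: "R u v i" for u v i
  proof -
    consider "var_of u \<in> S" | "u = x" | "u = opp x" using uv same_var by blast
    then show ?thesis
    proof cases
      case 1
      consider "var_of v \<in> S" | "v = x" | "v = opp x" using uv same_var by blast
      then show ?thesis
      proof cases
        case v: 1
        then show ?thesis using sat_onD[OF sat R 1 v] 1 by (simp add: \<tau>S)
      next
        case 2
        then show ?thesis using upx[of u i] R 1 \<tau>x by simp
      next
        case 3
        then show ?thesis using lowx[of "opp u" i] sym[OF R] 1 \<tau>x by simp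
      qed
    next
      case 2
      consider "var_of v \<in> S" | "v = x" | "v = opp x" using uv same_var by blast
      then show ?thesis
        by cases (use 2 R \<tau>x lowx lx refl in auto)
    next
      case 3
      consider "var_of v \<in> S" | "v = x" | "v = opp x" using uv same_var by blast
      then show ?thesis
        by cases (use 3 R sym[OF R] \<tau>x upx[of "opp v" i] ux refl in auto)
    qed
  qed
  then have "sat_on (insert (var_of x) S) \<tau>"
    by (simp add: sat_on_def mem_vertices)
  then show thesis
  proof (rule that)
    show "\<tau> y = \<sigma> y" if "y \<noteq> var_of x" for y using that by (simp add: \<tau>_def)
    show "lit \<tau> x \<le> a" if "a \<in> A" for a using kU that by (simp add: \<tau>x U_def)
    show "b \<le> lit \<tau> x" if "b \<in> B" for b using kL that by (simp add: \<tau>x L_def)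
  qed
qed

lemma extend_all:
  assumes "finite T" "finite S" "sat_on S \<sigma>"
  obtains \<tau> where "sat_on (S \<union> T) \<tau>" "\<And>y. y \<in> S \<Longrightarrow> \<tau> y = \<sigma> y"
proof -
  have "\<exists>\<tau>. sat_on (S \<union> T) \<tau> \<and> (\<forall>y\<in>S. \<tau> y = \<sigma> y)"
    using assms(1)
  proof (induction T)
    case empty
    then show ?case using assms by auto
  next
    case (insert z T)
    then obtain \<tau> where \<tau>: "sat_on (S \<union> T) \<tau>" "\<forall>y\<in>S. \<tau> y = \<sigma> y" by blast
    show ?case
    proof (cases "z \<in> S")
      case True
      then show ?thesis using \<tau> by (metis Un_iff Un_insert_right insert_absorb)
    next
      case False
      have "\<exists>\<tau>'. sat_on (insert z (S \<union> T)) \<tau>' \<and> (\<forall>y. y \<noteq> z \<longrightarrow> \<tau>' y = \<tau> y)"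
        by (rule extend[of "S \<union> T" \<tau> "Pos z" "{}" "{}"]) (use \<tau> insert False assms in auto)
      then show ?thesis using \<tau> False by (metis Un_insert_right)
    qed
  qed
  then show thesis using that by blast
qed

section \<open>Solutions, and counterexamples to bounds that are not derivable\<close>

lemma sat_on_empty: "sat_on {} \<sigma>"
  by (simp add: sat_on_def vertices_def)

lemma solution:
  assumes "finite X"
  obtains \<sigma> where "sat_on X \<sigma>"
  using extend_all[OF assms finite.emptyI sat_on_empty] by auto

lemma solution_beyond_opp:
  assumes "finite X" "var_of x \<in> X" "\<not> R x (opp x) d"
  obtains \<sigma> where "sat_on X \<sigma>" "d < lit \<sigma> (opp x) - lit \<sigma> x"
proof -
  \<comment> \<open>\<open>d div 2 + 1\<close> is the least integer whose double exceeds
    \<open>d\<close>. The variable of \<open>x\<close> is valued first, so only bounds on it alone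
    can conflict with this target.\<close>
  have *: "d div 2 + 1 \<le> j" if "R x (opp x) (2 * j)" for j
  proof (rule ccontr)
    assume "\<not> d div 2 + 1 \<le> j"
    then have "2 * j \<le> d" by linarith
    then show False using mono[OF that] assms(3) by blast
  qed
  obtain \<sigma> where \<sigma>: "sat_on {var_of x} \<sigma>" "d div 2 + 1 \<le> lit \<sigma> (opp x)"
    by (rule extend[of "{}" undefined "opp x" "{}" "{d div 2 + 1}"])
      (use * in \<open>auto simp: sat_on_empty vertices_def\<close>)
  obtain \<tau> where \<tau>: "sat_on ({var_of x} \<union> X) \<tau>" "\<And>y. y \<in> {var_of x} \<Longrightarrow> \<tau> y = \<sigma> y"
    using extend_all[OF assms(1) _ \<sigma>(1)] by auto
  have "lit \<tau> x = lit \<sigma> x" by (rule lit_cong) (use \<tau> in auto)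
  then have "d < lit \<tau> (opp x) - lit \<tau> x" using \<sigma>(2) by simp
  then show thesis using that \<tau>(1) assms(2) by (simp add: insert_absorb)
qed

text \<open>
  The first vertex gets a value so small that the constraints relating \<open>y\<close> to \<open>opp x\<close>
  and bounding \<open>y\<close> itself leave room for \<open>lit \<sigma> y \<ge> lit \<sigma> x + d + 1\<close>.
\<close>

lemma solution_beyond_distinct:
  assumes "finite X" "var_of x \<in> X" "var_of y \<in> X" "var_of x \<noteq> var_of y" "\<not> R x y d"
  obtains \<sigma> where "sat_on X \<sigma>" "d < lit \<sigma> y - lit \<sigma> x"
proof -
  \<comment> \<open>The division rounds \<open>2 * lit \<sigma> x \<le> i - d - 1\<close>, which
    arises when \<open>lit \<sigma> y\<close> is at most \<open>i - lit \<sigma> x\<close> and has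
    to reach \<open>lit \<sigma> x + d + 1\<close>.\<close>
  define A where "A = {(i - d - 1) div 2 |i. R (opp x) y i} \<union> {k - d - 1 |k. R (opp y) y (2 * k)}"
  have R_gt: "d < i" if "R x y i" for i
    using mono[OF that, of d] assms(5) by linarith
  have bddA: "bdd_below A"
    unfolding A_def by (auto intro!: bdd_below_R zdiv_mono1)
  obtain \<sigma> where \<sigma>: "sat_on {var_of x} \<sigma>" "\<And>a. a \<in> A \<Longrightarrow> lit \<sigma> x \<le> a"
  proof (rule extend[of "{}" undefined x A "{}"])
    fix a j assume "a \<in> A" and j: "R x (opp x) (2 * j)"
    then consider i where "R (opp x) y i" "a = (i - d - 1) div 2"
      | k where "R (opp y) y (2 * k)" "a = k - d - 1" by (auto simp: A_def)
    then show "- j \<le> a"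
    proof cases
      case 1
      then have "d < 2 * j + i" using R_gt trans j by blast
      then show ?thesis using 1 by linarith
    next
      case 2
      \<comment> \<open>This is where \<open>strong\<close> enters: there may be no chain of derived
        bounds connecting the bound on \<open>x\<close> with the one on \<open>y\<close>.\<close>
      then show ?thesis using R_gt[OF strong[OF j 2(1)]] by linarith
    qed
  qed (use bddA in \<open>auto simp: sat_on_empty vertices_def\<close>)
  define b where "b = lit \<sigma> x + d + 1"
  obtain \<tau> where \<tau>: "sat_on {var_of y, var_of x} \<tau>" "\<And>z. z \<noteq> var_of y \<Longrightarrow> \<tau> z = \<sigma> z" "b \<le> lit \<tau> y"
  proof (rule extend[of "{var_of x}" \<sigma> y "{}" "{b}"])
    fix b' j assume "b' \<in> {b}" "R (opp y) y (2 * j)"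
    then show "b' \<le> j" using \<sigma>(2)[of "j - d - 1"] by (auto simp: A_def b_def)
  next
    fix b' u i assume u: "b' \<in> {b}" "u \<in> vertices {var_of x}" "R u y i"
    then consider "u = x" | "u = opp x" using same_var by (fastforce simp: mem_vertices)
    then show "b' \<le> lit \<sigma> u + i"
    proof cases
      case 1
      then show ?thesis using u R_gt[of i] by (simp add: b_def)
    next
      case 2
      then have "lit \<sigma> x \<le> (i - d - 1) div 2" using u by (intro \<sigma>(2)) (auto simp: A_def)
      then show ?thesis using u 2 by (simp add: b_def)
    qed
  qed (use \<sigma> assms(4) in auto)
  obtain \<tau>' where \<tau>': "sat_on ({var_of y, var_of x} \<union> X) \<tau>'"
      "\<And>z. z \<in> {var_of y, var_of x} \<Longrightarrow> \<tau>' z = \<tau> z"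
    using extend_all[OF assms(1) _ \<tau>(1)] by auto
  have "lit \<tau>' x = lit \<sigma> x" "lit \<tau>' y = lit \<tau> y"
    using \<tau>(2) \<tau>'(2) assms(4) by (auto intro!: lit_cong)
  then have "d < lit \<tau>' y - lit \<tau>' x" using \<tau>(3) by (simp add: b_def)
  then show thesis using that \<tau>'(1) assms(2,3) by (simp add: insert_absorb)
qed

lemma solution_beyond:
  assumes "finite X" "var_of x \<in> X" "var_of y \<in> X" "\<not> R x y d"
  obtains \<sigma> where "sat_on X \<sigma>" "d < lit \<sigma> y - lit \<sigma> x"
proof -
  consider "y = x" | "y = opp x" | "var_of x \<noteq> var_of y" using same_var by metis
  then show thesis
  proof cases
    case 1
    then show ?thesis using that solution[OF assms(1)] assms(4) refl by auto
  next
    case 2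
    then show ?thesis using that solution_beyond_opp[OF assms(1,2)] assms(4) by auto
  next
    case 3
    then show ?thesis using that solution_beyond_distinct[OF assms(1-3) _ assms(4)] by auto
  qed
qed

end

section \<open>Walks and shortest paths\<close>

lemma weight_Nil [simp]: "weight [] = 0"
  and weight_Cons [simp]: "weight ((a, b, d) # p) = d + weight p"
  and weight_append [simp]: "weight (p @ q) = weight p + weight q"
  by (auto simp: weight_def)

lemma walk_append: "walk E u (p @ q) w \<longleftrightarrow> (\<exists>v. walk E u p v \<and> walk E v q w)"
  by (induction p arbitrary: u) auto

lemma walk_mono: "walk E u p v \<Longrightarrow> E \<subseteq> F \<Longrightarrow> walk F u p v"
  by (induction p arbitrary: u) auto

lemma walk_potential: "valid_potential E \<pi> \<Longrightarrow> walk E u p v \<Longrightarrow> \<pi> v - \<pi> u \<le> weight p"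
  by (induction p arbitrary: u) (fastforce simp: valid_potential_def)+

lemma valid_potential_no_neg_cycle: "valid_potential E \<pi> \<Longrightarrow> \<not> neg_cycle E"
  unfolding neg_cycle_def using walk_potential by fastforce

lemma valid_potential_mono: "valid_potential F \<pi> \<Longrightarrow> E \<subseteq> F \<Longrightarrow> valid_potential E \<pi>"
  by (auto simp: valid_potential_def)

text \<open>Records attainment besides the lower bound, which an infimum of real weights alone would
  not give. In this form a distance can be carried over to the reduced and the reversed graph by
  transforming single walks.\<close>

definition shortest :: "'a edge set \<Rightarrow> 'a \<Rightarrow> 'a \<Rightarrow> ereal \<Rightarrow> bool" where
  "shortest E u v z \<longleftrightarrow> (\<forall>p. walk E u p v \<longrightarrow> z \<le> ereal (weight p)) \<and>
     (z = \<infinity> \<or> (\<exists>p. walk E u p v \<and> z = ereal (weight p)))"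

lemma wSP_le: "walk E u p v \<Longrightarrow> wSP E u v \<le> ereal (weight p)"
  unfolding wSP_def by (rule INF_lower) simp

lemma wSP_eqI: "shortest E u v z \<Longrightarrow> wSP E u v = z"
  unfolding shortest_def by (intro antisym) (auto simp: wSP_def le_INF_iff intro: wSP_le[unfolded wSP_def])

definition int_weights :: "'a edge set \<Rightarrow> bool" where
  "int_weights E \<longleftrightarrow> (\<forall>(u, v, d)\<in>E. d \<in> \<int>)"

lemma walk_int: "int_weights E \<Longrightarrow> walk E u p v \<Longrightarrow> weight p \<in> \<int>"
  by (induction p arbitrary: u) (fastforce simp: int_weights_def)+

text \<open>Weights of walks are integers and a potential difference bounds them below, so a least
  one exists. The subtraction in \<open>?f\<close> shifts them into the natural numbers, where least
  elements are available.\<close>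

lemma shortest_exists:
  assumes "int_weights E" "valid_potential E \<pi>"
  obtains z where "shortest E u v z"
proof (cases "\<exists>p. walk E u p v")
  case False
  then show thesis using that[of \<infinity>] by (auto simp: shortest_def)
next
  case True
  let ?f = "\<lambda>p. nat (\<lfloor>weight p\<rfloor> - \<lfloor>\<pi> v - \<pi> u\<rfloor>)"
  obtain p where p: "walk E u p v" and min: "\<And>q. walk E u q v \<Longrightarrow> ?f p \<le> ?f q"
    using True ex_has_least_nat[of "\<lambda>p. walk E u p v" _ ?f] by blast
  have "weight p \<le> weight q" if q: "walk E u q v" for q
  proof -
    have "\<lfloor>\<pi> v - \<pi> u\<rfloor> \<le> \<lfloor>weight p\<rfloor>" "\<lfloor>\<pi> v - \<pi> u\<rfloor> \<le> \<lfloor>weight q\<rfloor>"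
      using walk_potential[OF assms(2)] p q by (auto intro!: floor_mono)
    then have "\<lfloor>weight p\<rfloor> \<le> \<lfloor>weight q\<rfloor>" using min[OF q] by linarith
    then show ?thesis using walk_int[OF assms(1)] p q by (metis Ints_cases floor_of_int of_int_le_iff)
  qed
  then show thesis using that[of "ereal (weight p)"] p by (auto simp: shortest_def)
qed

lemma shortest_wSP: "int_weights E \<Longrightarrow> valid_potential E \<pi> \<Longrightarrow> shortest E u v (wSP E u v)"
  by (metis shortest_exists wSP_eqI)

lemma wSP_cases:
  assumes "int_weights E" "valid_potential E \<pi>"
  obtains "wSP E u v = \<infinity>" "\<nexists>p. walk E u p v"
  | p i where "walk E u p v" "weight p = of_int i" "wSP E u v = ereal (of_int i)"
proof -
  have "shortest E u v (wSP E u v)" using assms by (rule shortest_wSP)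
  then consider "wSP E u v = \<infinity>" | p where "walk E u p v" "wSP E u v = ereal (weight p)"
    by (auto simp: shortest_def)
  then show thesis
  proof cases
    case 1
    then show thesis using that(1) wSP_le[of E u _ v] by fastforce
  next
    case 2
    then show thesis using that(2) walk_int[OF assms(1)] by (metis Ints_cases)
  qed
qed

lemma wSP_triangle:
  assumes "int_weights E" "valid_potential E \<pi>"
  shows "wSP E u w \<le> wSP E u v + wSP E v w"
proof (cases rule: wSP_cases[OF assms, of u v])
  case (2 p i)
  note uv = 2
  show ?thesis
  proof (cases rule: wSP_cases[OF assms, of v w])
    case (2 q j)
    then have "walk E u (p @ q) w" using uv walk_append by metis
    from wSP_le[OF this] show ?thesis using 2 uv by simp
  qed (use uv in simp)
qed simp

lemma wSP_edge: "(u, v, d) \<in> E \<Longrightarrow> wSP E u v \<le> ereal d"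
  using wSP_le[of E u "[(u, v, d)]" v] by simp

lemma wSP_mono: "E \<subseteq> F \<Longrightarrow> wSP F u v \<le> wSP E u v"
  unfolding wSP_def by (rule INF_superset_mono) (auto intro: walk_mono)

section \<open>Shortest paths after inserting an edge\<close>

lemma walk_insert_cases:
  assumes "walk (insert (a, b, d) E) u p v"
  shows "walk E u p v \<or> (\<exists>q r. walk (insert (a, b, d) E) u q a \<and>
    walk (insert (a, b, d) E) b r v \<and> weight p = weight q + d + weight r)"
  using assms
proof (induction p arbitrary: u)
  case (Cons e p)
  obtain x y w where e: "e = (x, y, w)" by (cases e)
  have x: "x = u" and p: "walk (insert (a, b, d) E) y p v" and e_in: "(u, y, w) \<in> insert (a, b, d) E"
    using Cons.prems by (auto simp: e)
  show ?case
  proof (cases "(u, y, w) = (a, b, d)")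
    case True
    then have "walk (insert (a, b, d) E) u [] a" by simp
    then show ?thesis using True p e by (intro disjI2 exI[of _ "[]"] exI[of _ p]) auto
  next
    case False
    from Cons.IH[OF p] show ?thesis
    proof
      assume "walk E y p v"
      then show ?thesis using False e_in e x by auto
    next
      assume "\<exists>q r. walk (insert (a, b, d) E) y q a \<and>
        walk (insert (a, b, d) E) b r v \<and> weight p = weight q + d + weight r"
      then obtain q r where "walk (insert (a, b, d) E) y q a" "walk (insert (a, b, d) E) b r v"
        "weight p = weight q + d + weight r" by blast
      then show ?thesis using e x e_in
        by (intro disjI2 exI[of _ "e # q"] exI[of _ r]) auto
    qed
  qed
qed auto

text \<open>The upper estimate concatenates a walk to \<open>a\<close>, the new edge and a walk from
  \<open>b\<close>; the lower one cuts an optimal walk at one use of the edge. The pieces may use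
  the edge again, which is harmless because the right-hand side has distances of the enlarged graph,
  the very ones that the algorithm computes.\<close>

lemma wSP_insert:
  assumes "int_weights E'" "valid_potential E' \<pi>" and E': "E' = insert (a, b, d) E"
  shows "wSP E' u v = min (wSP E u v) (wSP E' u a + ereal d + wSP E' b v)"
proof (rule antisym)
  have "wSP E' u v \<le> wSP E' u a + wSP E' a v" by (rule wSP_triangle[OF assms(1,2)])
  also have "\<dots> \<le> wSP E' u a + (wSP E' a b + wSP E' b v)"
    by (intro add_left_mono wSP_triangle[OF assms(1,2)])
  also have "\<dots> \<le> wSP E' u a + (ereal d + wSP E' b v)"
    by (intro add_left_mono add_right_mono wSP_edge) (simp add: E')
  finally show "wSP E' u v \<le> min (wSP E u v) (wSP E' u a + ereal d + wSP E' b v)"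
    using wSP_mono[of E E' u v] by (auto simp: E' add.assoc)
next
  show "min (wSP E u v) (wSP E' u a + ereal d + wSP E' b v) \<le> wSP E' u v"
  proof (cases rule: wSP_cases[OF assms(1,2), of u v])
    case (2 p i)
    from walk_insert_cases[of a b d E u p v] 2(1) E'
    consider "walk E u p v" | q r where "walk E' u q a" "walk E' b r v" "weight p = weight q + d + weight r"
      by auto
    then show ?thesis
    proof cases
      case 1
      then show ?thesis using 2 wSP_le[OF 1] by (simp add: min.coboundedI1)
    next
      case (2 q r)
      have "wSP E' u a + ereal d + wSP E' b v \<le> ereal (weight q) + ereal d + ereal (weight r)"
        using 2 by (intro add_mono wSP_le order_refl)
      also have "\<dots> = wSP E' u v" using 2 \<open>weight p = of_int i\<close> \<open>wSP E' u v = _\<close> by simp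
      finally show ?thesis by (rule min.coboundedI2)
    qed
  qed simp
qed

section \<open>Derivable bounds\<close>

definition dist_le :: "'a edge set \<Rightarrow> 'a \<Rightarrow> 'a \<Rightarrow> int \<Rightarrow> bool" where
  "dist_le E u v i \<longleftrightarrow> (\<exists>p. walk E u p v \<and> weight p \<le> of_int i)"

definition skew :: "'v vertex edge set \<Rightarrow> bool" where
  "skew E \<longleftrightarrow> (\<forall>u v d. (u, v, d) \<in> E \<longrightarrow> (opp v, opp u, d) \<in> E)"

lemma skew_walk:
  assumes "skew E" "walk E u p v"
  obtains q where "walk E (opp v) q (opp u)" "weight q = weight p"
proof -
  have "\<exists>q. walk E (opp v) q (opp u) \<and> weight q = weight p"
    using assms(2)
  proof (induction p arbitrary: u)
    case Nil
    then show ?case by (intro exI[of _ "[]"]) auto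
  next
    case (Cons e p)
    obtain a b d where e: "e = (a, b, d)" by (cases e)
    then have a: "a = u" "(u, b, d) \<in> E" and "walk E b p v" using Cons.prems by auto
    then obtain q where "walk E (opp v) q (opp b)" "weight q = weight p" using Cons.IH by blast
    then show ?case using assms(1) a e
      by (intro exI[of _ "q @ [(opp b, opp u, d)]"]) (auto simp: walk_append skew_def)
  qed
  then show thesis using that by blast
qed

lemma wSP_skew:
  assumes "skew E"
  shows "wSP E (opp v) (opp u) = wSP E u v"
proof -
  have le: "wSP E (opp v) (opp u) \<le> wSP E u v" for u v
    unfolding wSP_def using assms by (intro INF_mono) (metis mem_Collect_eq order_refl skew_walk)
  show ?thesis using le[of v u] le[of "opp u" "opp v"] by simp
qed

lemma dist_le_skew: "skew E \<Longrightarrow> dist_le E u v i \<Longrightarrow> dist_le E (opp v) (opp u) i"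
  unfolding dist_le_def by (metis skew_walk)

lemma dist_le_trans: "dist_le E u v i \<Longrightarrow> dist_le E v w j \<Longrightarrow> dist_le E u w (i + j)"
  unfolding dist_le_def by (metis add_mono of_int_add walk_append weight_append)

lemma dist_le_mono: "dist_le E u v i \<Longrightarrow> i \<le> j \<Longrightarrow> dist_le E u v j"
  unfolding dist_le_def by (meson of_int_le_iff order_trans)

lemma dist_le_potential: "valid_potential E \<pi> \<Longrightarrow> dist_le E u v i \<Longrightarrow> \<pi> v - \<pi> u \<le> of_int i"
  unfolding dist_le_def using walk_potential by fastforce

lemma dist_le_refl: "dist_le E u u 0"
  unfolding dist_le_def by (intro exI[of _ "[]"]) simp

text \<open>For an integer \<open>w\<close>, \<open>\<lfloor>w / 2\<rfloor> \<le> j\<close> means \<open>w \<le> 2 * j + 1\<close>.\<close>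

definition bound_le :: "'v vertex edge set \<Rightarrow> 'v vertex \<Rightarrow> int \<Rightarrow> bool" where
  "bound_le E u j \<longleftrightarrow> dist_le E u (opp u) (2 * j + 1)"

text \<open>The second alternative adds the rounded bounds \<open>- lit \<sigma> u \<le> j\<close>
  and \<open>lit \<sigma> v \<le> k\<close>.\<close>

definition derivable :: "'v vertex edge set \<Rightarrow> 'v vertex \<Rightarrow> 'v vertex \<Rightarrow> int \<Rightarrow> bool" where
  "derivable E u v i \<longleftrightarrow> dist_le E u v i \<or>
     (\<exists>j k. bound_le E u j \<and> bound_le E (opp v) k \<and> j + k \<le> i)"

lemma derivableI:
  "bound_le E u j \<Longrightarrow> bound_le E (opp v) k \<Longrightarrow> j + k \<le> i \<Longrightarrow> derivable E u v i"
  unfolding derivable_def by blast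

lemma bound_le_mono: "bound_le E u i \<Longrightarrow> i \<le> j \<Longrightarrow> bound_le E u j"
  unfolding bound_le_def by (erule dist_le_mono) simp

text \<open>Walk from \<open>u\<close> to \<open>v\<close>, on to \<open>opp v\<close>, and back to
  \<open>opp u\<close> along the mirror image. The weight \<open>i\<close> occurs twice, so the
  slack of one in \<open>2 * j + 1\<close> survives unchanged.\<close>

lemma bound_le_dist:
  assumes "skew E" "dist_le E u v i" "bound_le E v j"
  shows "bound_le E u (i + j)"
proof -
  have "dist_le E u (opp u) (i + (2 * j + 1 + i))"
    using assms dist_le_skew by (blast intro: dist_le_trans dest: bound_le_def[THEN iffD1])
  then show ?thesis unfolding bound_le_def by (rule dist_le_mono) simp
qed

text \<open>Between opposite vertices both summands of the second alternative bound the same vertex,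
  and the smaller of them is at most half their sum. Conversely, a rounded bound is added to itself,
  so only even totals matter.\<close>

lemma derivable_opp_iff: "derivable E u (opp u) i \<longleftrightarrow> bound_le E u (i div 2)"
proof
  assume "derivable E u (opp u) i"
  then consider "dist_le E u (opp u) i" | j k where "bound_le E u j" "bound_le E u k" "j + k \<le> i"
    by (auto simp: derivable_def)
  then show "bound_le E u (i div 2)"
  proof cases
    case 1
    then show ?thesis unfolding bound_le_def by (rule dist_le_mono) linarith
  next
    case 2
    then have "j \<le> i div 2 \<or> k \<le> i div 2" by linarith
    then show ?thesis using 2 bound_le_mono by blast
  qed
next
  assume "bound_le E u (i div 2)"
  moreover have "i div 2 + i div 2 \<le> i" by linarith
  ultimately show "derivable E u (opp u) i" unfolding derivable_def opp_opp by blast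
qed

text \<open>Transitivity is the substance: each way of chaining a path bound with a sum of bounds
  must again be one of the two kinds. Reflexivity also relies on consistency, since a sum of bounds
  from \<open>u\<close> to \<open>u\<close> pairs \<open>u\<close> with
  \<open>opp u\<close>.\<close>

lemma tight_system_derivable:
  assumes "skew E" and pot: "valid_potential E \<pi>"
    and cons: "\<And>u j k. bound_le E u j \<Longrightarrow> bound_le E (opp u) k \<Longrightarrow> 0 \<le> j + k"
  shows "tight_system (derivable E)"
proof
  note derivable_def [simp]
  fix u v w :: "'a vertex" and i j k :: int
  show "derivable E u v i \<Longrightarrow> i \<le> j \<Longrightarrow> derivable E u v j"
    using dist_le_mono by fastforce
  have 1: "derivable E u w (i + j)" if "dist_le E u v i" "bound_le E v a" "bound_le E (opp w) b" "a + b \<le> j" for a b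
    using that(4) by (intro derivableI[OF bound_le_dist[OF assms(1) that(1,2)] that(3)]) simp
  have 2: "derivable E u w (i + j)" if "dist_le E v w j" "bound_le E u a" "bound_le E (opp v) b" "a + b \<le> i" for a b
    using that(4)
    by (intro derivableI[OF that(2) bound_le_dist[OF assms(1) dist_le_skew[OF assms(1) that(1)] that(3)]]) simp
  \<comment> \<open>The bounds \<open>b\<close> on \<open>opp v\<close> and \<open>c\<close> on
    \<open>v\<close> satisfy \<open>0 \<le> b + c\<close>, so \<open>a + d\<close> is already at
    most \<open>i + j\<close>.\<close>
  have 3: "derivable E u w (i + j)" if "bound_le E u a" "bound_le E (opp v) b" "a + b \<le> i"
    "bound_le E v c" "bound_le E (opp w) d" "c + d \<le> j" for a b c d
    using cons[OF that(4,2)] that(3,6) by (intro derivableI[OF that(1,5)]) simp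
  show "derivable E u v i \<Longrightarrow> derivable E v w j \<Longrightarrow> derivable E u w (i + j)"
    using 1 2 3 dist_le_trans by (metis derivable_def)
  show "derivable E u v i \<Longrightarrow> derivable E (opp v) (opp u) i"
    unfolding derivable_def opp_opp using dist_le_skew[OF assms(1)] by (metis add.commute)
  show "derivable E u u i \<longleftrightarrow> 0 \<le> i"
  proof
    assume "derivable E u u i"
    then show "0 \<le> i" using dist_le_potential[OF pot, of u u i] cons by force
  next
    assume "0 \<le> i"
    then show "derivable E u u i"
      unfolding derivable_def by (intro disjI1 dist_le_mono[OF dist_le_refl])
  qed
  show "derivable E u (opp u) i \<Longrightarrow> derivable E u (opp u) (2 * (i div 2))"
    by (simp only: derivable_opp_iff) simp
  show "derivable E u v (j + k)"
    if "derivable E u (opp u) (2 * j)" "derivable E (opp v) v (2 * k)"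
    using that derivable_opp_iff[of E u "2 * j"] derivable_opp_iff[of E "opp v" "2 * k"]
    by (auto simp del: derivable_def simp: derivable_def[of E u v])
  \<comment> \<open>The potential bounds path weights from below. For a bound \<open>i\<close> the
    path weighs at most \<open>2 * i + 1\<close>, whence the subtraction of one before
    halving.\<close>
  have dist: "\<lfloor>\<pi> v - \<pi> u\<rfloor> \<le> i" if "dist_le E u v i" for u v i
    using dist_le_potential[OF pot that] by linarith
  have bound: "(\<lfloor>\<pi> (opp u) - \<pi> u\<rfloor> - 1) div 2 \<le> i" if "bound_le E u i" for u i
    using dist[OF that[unfolded bound_le_def]] by linarith
  show "\<exists>l. \<forall>i. derivable E u v i \<longrightarrow> l \<le> i"
    by (rule exI[of _ "min \<lfloor>\<pi> v - \<pi> u\<rfloor>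
        ((\<lfloor>\<pi> (opp u) - \<pi> u\<rfloor> - 1) div 2 + (\<lfloor>\<pi> v - \<pi> (opp v)\<rfloor> - 1) div 2)"])
      (use dist[of u v] bound[of u] bound[of "opp v"] in fastforce)
qed

section \<open>Integer satisfiability and entailment\<close>

text \<open>Any single edge carries the whole constraint, so the choice made by \<open>pick\<close>
  is immaterial. For \<open>Upper\<close> and \<open>Lower\<close> the edge is its own mirror image,
  and its doubled weight matches the difference of two opposite literals.\<close>

lemma edges_of_shape:
  assumes "(u, v, d) \<in> set (edges_of c)"
  shows "set (edges_of c) = {(u, v, d), (opp v, opp u, d)}" "d \<in> \<int>"
    and "holds \<sigma> c \<longleftrightarrow> of_int (lit \<sigma> v - lit \<sigma> u) \<le> d"
    and "var_of u \<in> vars c" "var_of v \<in> vars c"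
  using assms by (cases c; auto; linarith?)+

lemma edges_of_nonempty: "edges_of c \<noteq> []"
  by (cases c) auto

lemma skew_constraint_graph: "skew (constraint_graph \<phi>)"
  unfolding skew_def constraint_graph_def using edges_of_shape(1) by fast

lemma int_constraint_graph: "int_weights (constraint_graph \<phi>)"
  unfolding int_weights_def constraint_graph_def using edges_of_shape(2) by fast

text \<open>A solution is itself a potential. Soundness of path bounds is thus an instance of the
  telescoping along walks, and a satisfiable set has no negative cycle.\<close>

lemma valid_potential_lit:
  "\<forall>c\<in>\<phi>. holds \<sigma> c \<Longrightarrow> valid_potential (constraint_graph \<phi>) (\<lambda>u. of_int (lit \<sigma> u))"
  unfolding valid_potential_def constraint_graph_def using edges_of_shape(3) by fastforce

lemma dist_le_sound:
  "\<forall>c\<in>\<phi>. holds \<sigma> c \<Longrightarrow> dist_le (constraint_graph \<phi>) u v i \<Longrightarrow> lit \<sigma> v - lit \<sigma> u \<le> i"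
  using dist_le_potential[OF valid_potential_lit] by (metis of_int_diff of_int_le_iff)

lemma bound_le_sound:
  assumes "\<forall>c\<in>\<phi>. holds \<sigma> c" "bound_le (constraint_graph \<phi>) u j"
  shows "- lit \<sigma> u \<le> j"
  using dist_le_sound[OF assms(1) assms(2)[unfolded bound_le_def]] by simp

lemma derivable_sound:
  assumes "\<forall>c\<in>\<phi>. holds \<sigma> c" "derivable (constraint_graph \<phi>) u v i"
  shows "lit \<sigma> v - lit \<sigma> u \<le> i"
  using assms(2) dist_le_sound[OF assms(1)] bound_le_sound[OF assms(1), of u]
    bound_le_sound[OF assms(1), of "opp v"]
  by (fastforce simp: derivable_def)

lemma (in tight_system) sat_on_holds:
  assumes "sat_on X \<sigma>" "R = derivable (constraint_graph \<phi>)" "c \<in> \<phi>" "vars c \<subseteq> X"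
  shows "holds \<sigma> c"
proof -
  obtain u v d where e: "(u, v, d) \<in> set (edges_of c)"
    using edges_of_nonempty[of c] by (metis list.set_sel(1) prod_cases3)
  obtain i where d: "d = of_int i" using edges_of_shape(2)[OF e] by (auto elim: Ints_cases)
  have "(u, v, d) \<in> constraint_graph \<phi>" using e assms(3) by (auto simp: constraint_graph_def)
  then have "R u v i" unfolding assms(2) derivable_def dist_le_def
    by (intro disjI1 exI[of _ "[(u, v, d)]"]) (simp add: d)
  then have "lit \<sigma> v - lit \<sigma> u \<le> i"
    using edges_of_shape(4,5)[OF e] assms(4) by (intro sat_onD[OF assms(1)]) auto
  then show ?thesis using edges_of_shape(3)[OF e] d by simp
qed

text \<open>Consistent bounds alone would not do: a negative cycle through positive vertices only,
  as for \<open>x - y \<le> -1\<close> and \<open>y - x \<le> 0\<close>, may leave all bounds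
  infinite. The potential excludes this.\<close>

lemma satisfiable_if_consistent:
  assumes "finite X" "\<forall>c\<in>\<phi>. vars c \<subseteq> X" "valid_potential (constraint_graph \<phi>) \<pi>"
    and "\<And>u j k. bound_le (constraint_graph \<phi>) u j \<Longrightarrow> bound_le (constraint_graph \<phi>) (opp u) k \<Longrightarrow> 0 \<le> j + k"
  shows "satisfiable \<phi>"
proof -
  interpret tight_system "derivable (constraint_graph \<phi>)"
    using skew_constraint_graph assms(3,4) by (rule tight_system_derivable)
  show ?thesis unfolding satisfiable_def
    using solution[OF assms(1)] sat_on_holds assms(2) by metis
qed

lemma satisfiable_consistent:
  assumes "satisfiable \<phi>" "bound_le (constraint_graph \<phi>) u j" "bound_le (constraint_graph \<phi>) (opp u) k"
  shows "0 \<le> j + k"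
proof -
  obtain \<sigma> where \<sigma>: "\<forall>c\<in>\<phi>. holds \<sigma> c" using assms(1) by (auto simp: satisfiable_def)
  show ?thesis using bound_le_sound[OF \<sigma> assms(2)] bound_le_sound[OF \<sigma> assms(3)] by simp
qed

text \<open>Completeness is by contraposition: if the bound is not derivable,
  \<open>solution_beyond\<close> yields a solution of \<phi> that violates it.\<close>

lemma entails_iff_derivable:
  assumes "finite X" "\<forall>c\<in>\<phi>. vars c \<subseteq> X" "satisfiable \<phi>"
    and e: "(x, y, of_int d) \<in> set (edges_of c)" and "vars c \<subseteq> X"
  shows "entails \<phi> c \<longleftrightarrow> derivable (constraint_graph \<phi>) x y d"
proof
  assume "derivable (constraint_graph \<phi>) x y d"
  then show "entails \<phi> c"
    unfolding entails_def edges_of_shape(3)[OF e] of_int_le_iff using derivable_sound by blast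
next
  assume entails: "entails \<phi> c"
  obtain \<sigma> where "\<forall>c\<in>\<phi>. holds \<sigma> c" using assms(3) by (auto simp: satisfiable_def)
  note pot = valid_potential_lit[OF this]
  interpret tight_system "derivable (constraint_graph \<phi>)"
    by (rule tight_system_derivable[OF skew_constraint_graph pot satisfiable_consistent[OF assms(3)]])
  show "derivable (constraint_graph \<phi>) x y d"
  proof (rule ccontr)
    assume "\<not> ?thesis"
    then obtain \<sigma> where \<sigma>: "sat_on X \<sigma>" "d < lit \<sigma> y - lit \<sigma> x"
      using solution_beyond[OF assms(1)] edges_of_shape(4,5)[OF e] assms(5) by blast
    then have "holds \<sigma> c" using entails sat_on_holds assms(2) unfolding entails_def by blast
    then show False using \<sigma>(2) edges_of_shape(3)[OF e] by (metis not_le of_int_le_iff)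
  qed
qed

section \<open>The bounds function\<close>

lemma ereal_div2: "ereal x / 2 = ereal (x / 2)"
  using ereal_divide[of 2 x] by simp

lemma efloor_half: "efloor (ereal (of_int i) / 2) = ereal (of_int (i div 2))"
  by (simp add: ereal_div2 efloor_def) (metis floor_divide_of_int_eq of_int_numeral)

lemma efloor_infty: "efloor \<infinity> = \<infinity>"
  by (simp add: efloor_def)

lemma efloor_mono: "x \<le> y \<Longrightarrow> efloor x \<le> efloor y"
  by (cases x; cases y) (auto simp: efloor_def floor_mono)

lemma efloor_min: "efloor (min x y) = min (efloor x) (efloor y)"
  using efloor_mono[of x y] efloor_mono[of y x] by (auto simp: min_def)

lemma min_half: "min x y / 2 = min (x / 2) (y / 2)" for x y :: ereal
  by (cases x; cases y) (auto simp: ereal_div2 min_def)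

lemma wSP_le_iff:
  assumes "int_weights E" "valid_potential E \<pi>"
  shows "wSP E u v \<le> ereal (of_int i) \<longleftrightarrow> dist_le E u v i"
proof (cases rule: wSP_cases[OF assms, of u v])
  case 1
  then show ?thesis by (auto simp: dist_le_def)
next
  case (2 p j)
  then show ?thesis using wSP_le[of E u _ v] by (fastforce simp: dist_le_def)
qed

text \<open>The bridge from the extended real \<rho> to the integer predicates. An infinite value
  means that no bound holds; a finite one is the least bound.\<close>

lemma bounds_cases:
  assumes "valid_potential (constraint_graph \<phi>) \<pi>"
  obtains "bounds \<phi> u = \<infinity>" "\<And>j. \<not> bound_le (constraint_graph \<phi>) u j"
  | i where "bounds \<phi> u = ereal (of_int i)" "\<And>j. bound_le (constraint_graph \<phi>) u j \<longleftrightarrow> i \<le> j"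
proof (cases rule: wSP_cases[OF int_constraint_graph assms, of u "opp u"])
  case 1
  then show thesis using that(1)
    by (auto simp: bounds_def efloor_infty bound_le_def dist_le_def)
next
  case (2 p i)
  have "bound_le (constraint_graph \<phi>) u j \<longleftrightarrow> i div 2 \<le> j" for j
  proof -
    have "bound_le (constraint_graph \<phi>) u j \<longleftrightarrow> i \<le> 2 * j + 1"
      unfolding bound_le_def wSP_le_iff[OF int_constraint_graph assms, symmetric] 2(3) ereal_less_eq
      by linarith
    then show ?thesis by linarith
  qed
  moreover have "bounds \<phi> u = ereal (of_int (i div 2))"
    unfolding bounds_def 2(3) by (rule efloor_half)
  ultimately show thesis using that(2) by blast
qed

lemma bounds_nonneg_iff:
  assumes "valid_potential (constraint_graph \<phi>) \<pi>"
  shows "0 \<le> bounds \<phi> u + bounds \<phi> (opp u) \<longleftrightarrow>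
    (\<forall>j k. bound_le (constraint_graph \<phi>) u j \<longrightarrow> bound_le (constraint_graph \<phi>) (opp u) k \<longrightarrow> 0 \<le> j + k)"
  by (cases rule: bounds_cases[OF assms, of u]; cases rule: bounds_cases[OF assms, of "opp u"])
    (auto simp: order_trans[OF _ add_mono] simp flip: of_int_add)

lemma less_bounds_iff:
  assumes "valid_potential (constraint_graph \<phi>) \<pi>"
  shows "ereal (of_int d) < bounds \<phi> x + bounds \<phi> y \<longleftrightarrow>
    (\<nexists>j k. bound_le (constraint_graph \<phi>) x j \<and> bound_le (constraint_graph \<phi>) y k \<and> j + k \<le> d)"
  by (cases rule: bounds_cases[OF assms, of x]; cases rule: bounds_cases[OF assms, of y])
    (auto simp flip: of_int_add, smt+)

lemma less_wSP_bounds_iff: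
  assumes "valid_potential (constraint_graph \<phi>) \<pi>"
  shows "ereal (of_int d) < wSP (constraint_graph \<phi>) x y \<and>
      ereal (of_int d) < bounds \<phi> x + bounds \<phi> (opp y) \<longleftrightarrow> \<not> derivable (constraint_graph \<phi>) x y d"
  unfolding less_bounds_iff[OF assms] derivable_def
  unfolding not_le[symmetric] wSP_le_iff[OF int_constraint_graph assms] by blast

section \<open>Distances, bounds and entailment after adding a constraint\<close>

lemma constraint_graph_insert:
  "(u, v, d) \<in> set (edges_of c) \<Longrightarrow>
    constraint_graph (insert c \<phi>) = insert (u, v, d) (insert (opp v, opp u, d) (constraint_graph \<phi>))"
  using edges_of_shape(1)[of u v d c] by (auto simp: constraint_graph_def)

text \<open>
  A path through the second edge of \<open>c\<close> is mirrored into one through the first edge.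
\<close>

lemma wSP_insert_constraint:
  assumes e: "(u, v, d) \<in> set (edges_of c)"
    and pot: "valid_potential (constraint_graph (insert c \<phi>)) \<pi>"
  defines "G \<equiv> constraint_graph \<phi>" and "G' \<equiv> constraint_graph (insert c \<phi>)"
  shows "wSP G' x y = min (wSP G x y) (min (wSP G' x u + ereal d + wSP G' v y)
    (wSP G' (opp y) u + ereal d + wSP G' v (opp x)))"
proof -
  let ?F = "insert (opp v, opp u, d) G"
  have G': "G' = insert (u, v, d) ?F" unfolding G_def G'_def by (rule constraint_graph_insert[OF e])
  have int: "int_weights G'" unfolding G'_def by (rule int_constraint_graph)
  have pot: "valid_potential G' \<pi>" unfolding G'_def by (rule pot)
  have skew: "skew G'" unfolding G'_def by (rule skew_constraint_graph)
  have 1: "wSP G' x y = min (wSP ?F x y) (wSP G' x u + ereal d + wSP G' v y)"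
    by (rule wSP_insert[OF int pot G'])
  have G'2: "G' = insert (opp v, opp u, d) (insert (u, v, d) G)" unfolding G' by (rule insert_commute)
  \<comment> \<open>Mirroring swaps the two halves: the part leading to \<open>opp v\<close> becomes
    the part starting at \<open>v\<close>, and the part from \<open>opp u\<close> becomes the part
    ending in \<open>u\<close>.\<close>
  have mirror: "wSP G' x (opp v) + ereal d + wSP G' (opp u) y =
      wSP G' (opp y) u + ereal d + wSP G' v (opp x)"
    using wSP_skew[OF skew, where u=v and v="opp x"] wSP_skew[OF skew, where u="opp y" and v=u] by (simp add: ac_simps)
  \<comment> \<open>For the intermediate graph a lower estimate is enough: its distances are
    replaced by the smaller ones of \<open>G'\<close>. Equality is restored by the upper estimates
    that follow, which hold in \<open>G'\<close> directly.\<close>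
  have F: "min (wSP G x y) (wSP G' x (opp v) + ereal d + wSP G' (opp u) y) \<le> wSP ?F x y"
  proof -
    have "int_weights ?F" "valid_potential ?F \<pi>"
      using int pot by (auto simp: G' int_weights_def valid_potential_def)
    note wSP_insert[OF this HOL.refl, of x y]
    moreover have "wSP G' x (opp v) + ereal d + wSP G' (opp u) y \<le>
        wSP ?F x (opp v) + ereal d + wSP ?F (opp u) y"
      by (intro add_mono wSP_mono order_refl) (auto simp: G')
    ultimately show ?thesis by (auto simp: min_le_iff_disj)
  qed
  have "wSP G' x y \<le> wSP G' x (opp v) + ereal d + wSP G' (opp u) y"
    using wSP_insert[OF int pot G'2, of x y] by simp
  moreover have "wSP G' x y \<le> wSP G x y" by (rule wSP_mono) (auto simp: G')
  ultimately show ?thesis using 1 F unfolding mirror by (auto simp: min_def split: if_splits)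
qed

text \<open>For \<open>y = opp x\<close> the two new terms of \<open>wSP_insert_constraint\<close>
  coincide, and halving and flooring commute with minima. Hence the stored old bound suffices and
  the old distance need not be known.\<close>

lemma bounds_insert:
  assumes e: "(u, v, d) \<in> set (edges_of c)"
    and pot: "valid_potential (constraint_graph (insert c \<phi>)) \<pi>"
  defines "G' \<equiv> constraint_graph (insert c \<phi>)"
  shows "bounds (insert c \<phi>) x =
    min (bounds \<phi> x) (efloor ((wSP G' x u + ereal d + wSP G' v (opp x)) / 2))"
  unfolding bounds_def wSP_insert_constraint[OF e pot, of x "opp x"] G'_def
    opp_opp min.idem min_half efloor_min by (rule HOL.refl)

text \<open>Since \<phi> does not entail \<open>c'\<close>, the old distance from \<open>x\<close>
  to \<open>y\<close> already exceeds \<open>d'\<close>. Of the minimum describing the new distance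
  only the two terms through \<open>c\<close> remain to be tested, and these are available from one
  edge of \<open>c\<close>.\<close>

lemma entails_insert_iff:
  assumes "finite X" "\<forall>c'\<in>insert c \<phi>. vars c' \<subseteq> X" "vars c' \<subseteq> X"
    and sat: "satisfiable (insert c \<phi>)"
    and e: "(u, v, d) \<in> set (edges_of c)" and e': "(x, y, d') \<in> set (edges_of c')"
    and "\<not> entails \<phi> c'"
  defines "G' \<equiv> constraint_graph (insert c \<phi>)"
  shows "\<not> entails (insert c \<phi>) c' \<longleftrightarrow>
    ereal d' < wSP G' x u + ereal d + wSP G' v y \<and>
    ereal d' < wSP G' (opp y) u + ereal d + wSP G' v (opp x) \<and>
    ereal d' < bounds (insert c \<phi>) x + bounds (insert c \<phi>) (opp y)"
proof -
  obtain i where d': "d' = of_int i" using edges_of_shape(2)[OF e'] by (auto elim: Ints_cases)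
  obtain \<sigma> where \<sigma>: "\<forall>c\<in>insert c \<phi>. holds \<sigma> c" using sat by (auto simp: satisfiable_def)
  note pot = valid_potential_lit[OF \<sigma>]
  have sub: "constraint_graph \<phi> \<subseteq> constraint_graph (insert c \<phi>)" by (auto simp: constraint_graph_def)
  have "satisfiable \<phi>" using \<sigma> by (auto simp: satisfiable_def)
  then have "\<not> derivable (constraint_graph \<phi>) x y i"
    using entails_iff_derivable[OF assms(1) _ _ e'[unfolded d'] assms(3)] assms(2,7) by blast
  then have "ereal d' < wSP (constraint_graph \<phi>) x y"
    using less_wSP_bounds_iff[OF valid_potential_mono[OF pot sub]] d' by blast
  moreover have "\<not> entails (insert c \<phi>) c' \<longleftrightarrow> ereal d' < wSP G' x y \<and>
      ereal d' < bounds (insert c \<phi>) x + bounds (insert c \<phi>) (opp y)"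
    unfolding G'_def d' less_wSP_bounds_iff[OF pot]
    using entails_iff_derivable[OF assms(1,2) sat e'[unfolded d'] assms(3)] by blast
  ultimately show ?thesis
    unfolding G'_def wSP_insert_constraint[OF e pot, of x y] by auto
qed

section \<open>Cost of the elementary computations\<close>

lemma result_bind [simp]: "result (bind_cost m f) = result (f (result m))"
  and time_bind [simp]: "time (bind_cost m f) = time m + time (f (result m))"
  and space_bind [simp]: "space (bind_cost m f) = space m + space (f (result m))"
  by (simp_all add: bind_cost_def Let_def)

lemma result_return [simp]: "result (return x) = x"
  and time_return [simp]: "time (return x) = 1"
  and space_return [simp]: "space (return x) = 0"
  by (simp_all add: return_def)

lemma time_tick [simp]: "time (tick k) = k"
  and space_tick [simp]: "space (tick k) = 0"
  and time_alloc [simp]: "time (alloc k) = 0"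
  and space_alloc [simp]: "space (alloc k) = k"
  by (simp_all add: tick_def alloc_def)

lemma result_for_each: "result (for_each xs f s) = fold (\<lambda>x s. result (f x s)) xs s"
  by (induction xs arbitrary: s) auto

lemma time_for_each_le:
  "(\<And>x s. time (f x s) \<le> t) \<Longrightarrow> time (for_each xs f s) \<le> 1 + length xs * (1 + t)"
proof (induction xs arbitrary: s)
  case (Cons x xs)
  show ?case using Cons.IH[OF Cons.prems, of "result (f x s)"] Cons.prems[of x s] by simp
qed auto

lemma space_for_each_le:
  "(\<And>x s. space (f x s) \<le> t) \<Longrightarrow> space (for_each xs f s) \<le> length xs * t"
proof (induction xs arbitrary: s)
  case (Cons x xs)
  show ?case using Cons.IH[OF Cons.prems, of "result (f x s)"] Cons.prems[of x s] by simp
qed auto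

lemma new_array [simp]:
  "result (new_array V b) = (\<lambda>_. b)" "time (new_array V b) = length V + 1"
  "space (new_array V b) = length V"
  by (simp_all add: new_array_def)

lemma result_tabulate: "x \<in> set V \<Longrightarrow> result (tabulate V f) x = f x"
proof -
  have "fold (\<lambda>x A. A(x := f x)) V A x = (if x \<in> set V then f x else A x)" for A
    by (induction V arbitrary: A) auto
  then show "x \<in> set V \<Longrightarrow> result (tabulate V f) x = f x"
    by (simp add: tabulate_def result_for_each)
qed

lemma time_tabulate_le: "time (tabulate V f) \<le> 3 * length V + 2"
  using time_for_each_le[of "\<lambda>x A. return (A(x := f x))" 1 V "\<lambda>_. \<infinity>"] by (simp add: tabulate_def)

lemma space_tabulate_le: "space (tabulate V f) \<le> length V"
  using space_for_each_le[of "\<lambda>x A. return (A(x := f x))" 0 V "\<lambda>_. \<infinity>"] by (simp add: tabulate_def)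

section \<open>Dijkstra's algorithm\<close>

lemma result_adjacency:
  "result (adjacency G) a = rev (map snd (filter (\<lambda>e. fst e = a) (snd G)))"
proof -
  have "fold (\<lambda>e A. A(fst e := snd e # A (fst e))) es A a
      = rev (map snd (filter (\<lambda>e. fst e = a) es)) @ A a" for es and A :: "'a \<Rightarrow> ('a \<times> real) list"
    by (induction es arbitrary: A) auto
  then show ?thesis by (simp add: adjacency_def result_for_each case_prod_unfold)
qed

lemma set_adjacency: "set (result (adjacency G) a) = {(b, w). (a, b, w) \<in> set (snd G)}"
  by (force simp: result_adjacency)

text \<open>The amortization behind the linear edge term: an edge is listed only at its source, so
  scanning every vertex once scans every edge at most once.\<close>

lemma sum_length_adjacency:
  assumes "finite V"
  shows "(\<Sum>a\<in>V. length (result (adjacency G) a)) \<le> length (snd G)"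
proof -
  have "(\<Sum>a\<in>V. length (filter (\<lambda>e. fst e = a) es)) \<le> length es" for es :: "'a edge list"
  proof (induction es)
    case (Cons e es)
    have "(\<Sum>a\<in>V. length (filter (\<lambda>e. fst e = a) (e # es))) =
        (\<Sum>a\<in>V. (if a = fst e then 1 else 0) + length (filter (\<lambda>e. fst e = a) es))"
      by (intro sum.cong) auto
    also have "\<dots> \<le> 1 + length es"
      using assms Cons.IH by (simp add: sum.distrib sum.delta)
    finally show ?case by simp
  qed simp
  then show ?thesis by (simp add: result_adjacency)
qed

lemma time_adjacency_le: "time (adjacency G) \<le> length (fst G) + 2 * length (snd G) + 2"
proof -
  have "time (for_each (snd G) (\<lambda>(a, b, w) A. bind_cost (alloc 1) (\<lambda>_. return (A(a := (b, w) # A a)))) A)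
    \<le> 1 + length (snd G) * (1 + 1)" for A :: "'a \<Rightarrow> ('a \<times> real) list"
    by (rule time_for_each_le) (auto split: prod.split)
  from this[of "\<lambda>_. []"] show ?thesis by (simp add: adjacency_def)
qed

lemma space_adjacency_le: "space (adjacency G) \<le> length (fst G) + length (snd G)"
proof -
  have "space (for_each (snd G) (\<lambda>(a, b, w) A. bind_cost (alloc 1) (\<lambda>_. return (A(a := (b, w) # A a)))) A)
    \<le> length (snd G) * 1" for A :: "'a \<Rightarrow> ('a \<times> real) list"
    by (rule space_for_each_le) (auto split: prod.split)
  from this[of "\<lambda>_. []"] show ?thesis by (simp add: adjacency_def)
qed

section \<open>Relaxation and the loop invariant\<close>

definition relax :: "'a \<Rightarrow> ('a \<times> real) list \<Rightarrow> ('a \<Rightarrow> ereal) \<Rightarrow> ('a \<Rightarrow> ereal) cost" where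
  "relax a = (\<lambda>l D. for_each l (\<lambda>(b, w) D.
     return (if D a + ereal w < D b then D(b := D a + ereal w) else D)) D)"

lemma cost_relax: "time (relax a l D) = 1 + 2 * length l" "space (relax a l D) = 0"
  unfolding relax_def by (induction l arbitrary: D) (auto split: prod.split)

text \<open>The loop reads \<open>D a\<close> from the array that it updates. Nonnegative weights
  keep this entry fixed, even in the presence of a loop at \<open>a\<close>, so all updates use the
  same value.\<close>

lemma relax:
  assumes "\<forall>(b, w)\<in>set l. 0 \<le> w"
  shows "result (relax a l D) a = D a" (is ?A)
    and "result (relax a l D) b \<le> D b" (is ?B)
    and "(b, w) \<in> set l \<Longrightarrow> result (relax a l D) b \<le> D a + ereal w" (is "_ \<Longrightarrow> ?C")
    and "result (relax a l D) b = D b \<or> (\<exists>w. (b, w) \<in> set l \<and> result (relax a l D) b = D a + ereal w)" (is ?D)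
proof -
  have "?A \<and> ?B \<and> ((b, w) \<in> set l \<longrightarrow> ?C) \<and> ?D"
    using assms
  proof (induction l arbitrary: D)
    case Nil
    then show ?case by (simp add: relax_def)
  next
    case (Cons e l)
    obtain c x where e: "e = (c, x)" by (cases e)
    define D1 where "D1 = (if D a + ereal x < D c then D(c := D a + ereal x) else D)"
    have eq: "result (relax a ((c, x) # l) D) = result (relax a l D1)"
      by (simp add: relax_def D1_def)
    have "0 \<le> x" using Cons.prems e by auto
    then have "\<not> D a + ereal x < D a" by (cases "D a") auto
    then have "D1 a = D a" by (auto simp: D1_def)
    moreover have "D1 b \<le> D b" by (auto simp: D1_def)
    moreover have "b = c \<Longrightarrow> D1 b \<le> D a + ereal x" by (auto simp: D1_def)
    moreover have "D1 b = D b \<or> (b = c \<and> D1 b = D a + ereal x)" by (auto simp: D1_def)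
    moreover have "\<forall>(b, w)\<in>set l. 0 \<le> w" using Cons.prems by auto
    note IH = Cons.IH[OF this, of D1]
    moreover from IH have "b = c \<Longrightarrow> result (relax a l D1) b \<le> D1 c" by simp
    ultimately show ?case unfolding e eq by (auto intro: order_trans)
  qed
  then show ?A ?B "(b, w) \<in> set l \<Longrightarrow> ?C" ?D by auto
qed

text \<open>Rather than calling extracted labels final distances, the invariant says that labels
  belong to walks and that edges leaving extracted vertices are satisfied. For an empty queue the
  latter holds for all edges, which forces optimality.\<close>

definition dijkstra_inv ::
    "'a set \<Rightarrow> 'a edge set \<Rightarrow> 'a \<Rightarrow> 'a set \<Rightarrow> ('a \<Rightarrow> ereal) \<Rightarrow> bool" where
  "dijkstra_inv V E s Q D \<longleftrightarrow> Q \<subseteq> V \<and> D s \<le> 0 \<and>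
     (\<forall>b. D b = \<infinity> \<or> (\<exists>p. walk E s p b \<and> D b = ereal (weight p))) \<and>
     (\<forall>(a, b, w)\<in>E. a \<notin> Q \<longrightarrow> D b \<le> D a + ereal w) \<and>
     (\<forall>a\<in>V - Q. \<forall>q\<in>Q. D a \<le> D q)"

lemma dijkstra_inv_step:
  assumes inv: "dijkstra_inv V E s Q D" and nonneg: "\<forall>(a, b, w)\<in>E. 0 \<le> w"
    and E: "E \<subseteq> V \<times> V \<times> UNIV" and a: "a \<in> Q" "\<And>q. q \<in> Q \<Longrightarrow> D a \<le> D q"
    and l: "set l = {(b, w). (a, b, w) \<in> E}"
  shows "dijkstra_inv V E s (Q - {a}) (result (relax a l D))"
proof -
  let ?D = "result (relax a l D)"
  have le: "D x \<le> D x + ereal w" if "0 \<le> w" for x w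
    using that by (cases "D x") auto
  have nonneg': "\<forall>(b, w)\<in>set l. 0 \<le> w" using nonneg l by auto
  note relax = relax[OF this, where D=D and a=a]
  \<comment> \<open>A relaxation writes only values of at least \<open>D a\<close>, while extracted
    labels are at most \<open>D a\<close>; so it cannot lower them.\<close>
  have fixed: "?D x = D x" if "x \<in> V - Q" for x
  proof -
    have "D x \<le> D a" using inv that a(1) by (auto simp: dijkstra_inv_def)
    moreover have "D a \<le> ?D x \<or> ?D x = D x" using relax(4)[where b=x] le nonneg' by fastforce
    ultimately show ?thesis using relax(2)[where b=x] by auto
  qed
  have lower: "D a \<le> ?D q" if "q \<in> Q" for q
    using relax(4)[where b=q] a(2)[OF that] le nonneg' by fastforce
  have "?D s \<le> 0" using relax(2)[where b=s] inv by (auto simp: dijkstra_inv_def intro: order_trans)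
  moreover have "?D b = \<infinity> \<or> (\<exists>p. walk E s p b \<and> ?D b = ereal (weight p))" for b
    using relax(4)[where b=b]
  proof
    assume "\<exists>w. (b, w) \<in> set l \<and> ?D b = D a + ereal w"
    then obtain w where w: "(a, b, w) \<in> E" "?D b = D a + ereal w" using l by auto
    show ?thesis
    proof (cases "D a = \<infinity>")
      case False
      then obtain p where "walk E s p a" "D a = ereal (weight p)"
        using inv by (auto simp: dijkstra_inv_def)
      then show ?thesis using w
        by (intro disjI2 exI[of _ "p @ [(a, b, w)]"]) (auto simp: walk_append)
    qed (use w in simp)
  qed (use inv in \<open>auto simp: dijkstra_inv_def\<close>)
  moreover have "?D b \<le> ?D x + ereal w" if "(x, b, w) \<in> E" "x \<notin> Q - {a}" for x b w
  proof (cases "x = a")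
    case True
    then show ?thesis using relax(1) relax(3)[where b=b and w=w] that l by simp
  next
    case False
    then have "D b \<le> D x + ereal w" "x \<in> V - Q"
      using inv that E by (auto simp: dijkstra_inv_def)
    then show ?thesis using fixed relax(2)[where b=b] by (metis order_trans)
  qed
  moreover have "?D x \<le> ?D q" if "x \<in> V - (Q - {a})" "q \<in> Q - {a}" for x q
  proof -
    have "D x \<le> D a" using that inv a(1) by (cases "x = a") (auto simp: dijkstra_inv_def)
    then show ?thesis using relax(2)[where b=x] lower[of q] that by (meson DiffD1 order_trans)
  qed
  moreover have "Q - {a} \<subseteq> V" using inv by (auto simp: dijkstra_inv_def)
  ultimately show ?thesis unfolding dijkstra_inv_def by auto
qed

text \<open>The edge inequalities telescope along a walk, starting from \<open>D s \<le> 0\<close>.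
  Attainment is already part of the invariant.\<close>

lemma dijkstra_inv_empty:
  assumes "dijkstra_inv V E s {} D"
  shows "shortest E s v (D v)"
proof -
  have "D v \<le> D u + ereal (weight p)" if "walk E u p v" for u p
    using that
  proof (induction p arbitrary: u)
    case Nil
    then show ?case by simp
  next
    case (Cons e p)
    obtain a b w where e: "e = (a, b, w)" by (cases e)
    have "D v \<le> D b + ereal (weight p)" using Cons e by auto
    also have "\<dots> \<le> D u + ereal w + ereal (weight p)"
      using assms Cons.prems e by (intro add_right_mono) (auto simp: dijkstra_inv_def)
    finally show ?case by (simp add: e add.assoc)
  qed
  moreover have "D s + ereal w \<le> ereal w" for w
    using assms add_right_mono[of "D s" 0 "ereal w"] by (simp add: dijkstra_inv_def)
  ultimately show ?thesis using assms
    unfolding shortest_def dijkstra_inv_def by (meson order_trans)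
qed

text \<open>The edge term is charged to the vertices still in the queue and shrinks with each
  extraction; \<open>N\<close> keeps the logarithm fixed meanwhile. The 4 consists of one step each
  for the iteration, the queue, the end of the inner loop and the return.\<close>

lemma dijkstra_loop:
  fixes adj :: "'a \<Rightarrow> ('a \<times> real) list"
  defines "body \<equiv> \<lambda>_ :: nat. \<lambda>(D, Q). bind_cost (tick (1 + ceillog2 (card Q)))
    (\<lambda>_. let a = arg_min_on D Q in bind_cost (relax a (adj a) D) (\<lambda>D'. return (D', Q - {a})))"
  assumes "\<And>a. set (adj a) = {(b, w). (a, b, w) \<in> E}" "\<forall>(a, b, w)\<in>E. 0 \<le> w"
    and "E \<subseteq> V \<times> V \<times> UNIV" "finite Q" "card Q = length xs" "length xs \<le> N"
    and "dijkstra_inv V E s Q D"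
  shows "dijkstra_inv V E s {} (fst (result (for_each xs body (D, Q)))) \<and>
    time (for_each xs body (D, Q)) \<le> 1 + length xs * (4 + ceillog2 N) + 2 * (\<Sum>a\<in>Q. length (adj a)) \<and>
    space (for_each xs body (D, Q)) = 0"
  using assms(5-)
proof (induction xs arbitrary: D Q)
  case (Cons x xs)
  define a where "a = arg_min_on D Q"
  have "Q \<noteq> {}" using Cons.prems by auto
  then have a: "a \<in> Q" "\<And>q. q \<in> Q \<Longrightarrow> D a \<le> D q"
    using arg_min_if_finite[of Q D] Cons.prems(1) by (force simp: a_def)+
  have "dijkstra_inv V E s (Q - {a}) (result (relax a (adj a) D))"
    using Cons.prems(4) assms(2-4) a by (intro dijkstra_inv_step) auto
  then have IH: "dijkstra_inv V E s {} (fst (result (for_each xs body (result (relax a (adj a) D), Q - {a}))))"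
    "time (for_each xs body (result (relax a (adj a) D), Q - {a}))
      \<le> 1 + length xs * (4 + ceillog2 N) + 2 * (\<Sum>a\<in>Q - {a}. length (adj a))"
    "space (for_each xs body (result (relax a (adj a) D), Q - {a})) = 0"
    using Cons.IH[of "Q - {a}"] Cons.prems a by auto
  have body: "result (body x (D, Q)) = (result (relax a (adj a) D), Q - {a})"
    "time (body x (D, Q)) = 3 + ceillog2 (card Q) + 2 * length (adj a)" "space (body x (D, Q)) = 0"
    by (simp_all add: body_def Let_def cost_relax flip: a_def)
  have "ceillog2 (card Q) \<le> ceillog2 N"
    using Cons.prems by (intro ceillog2_mono) simp
  moreover have "(\<Sum>a\<in>Q. length (adj a)) = length (adj a) + (\<Sum>a\<in>Q - {a}. length (adj a))"
    using a Cons.prems by (intro sum.remove) auto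
  ultimately show ?case using IH body by simp
qed simp

lemma dijkstra_unfold:
  "dijkstra G s = bind_cost (adjacency G) (\<lambda>adj. bind_cost (new_array (fst G) \<infinity>) (\<lambda>D.
     bind_cost (tick (length (fst G))) (\<lambda>_. bind_cost (alloc (length (fst G))) (\<lambda>_.
     bind_cost (for_each [0..<length (fst G)] (\<lambda>_ (D, Q).
       bind_cost (tick (1 + ceillog2 (card Q))) (\<lambda>_. let a = arg_min_on D Q in
         bind_cost (relax a (adj a) D) (\<lambda>D'. return (D', Q - {a})))) (D(s := 0), set (fst G)))
     (\<lambda>(D, Q). return D)))))"
  by (simp add: dijkstra_def relax_def)

lemma dijkstra:
  assumes "distinct (fst G)" "set (snd G) \<subseteq> set (fst G) \<times> set (fst G) \<times> UNIV"
    and "\<forall>(a, b, w)\<in>set (snd G). 0 \<le> w"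
  shows "shortest (set (snd G)) s v (result (dijkstra G s) v)"
    and "time (dijkstra G s) \<le>
      7 * length (fst G) + length (fst G) * ceillog2 (length (fst G)) + 4 * length (snd G) + 6"
    and "space (dijkstra G s) \<le> 3 * length (fst G) + length (snd G)"
proof -
  let ?V = "set (fst G)" and ?N = "length (fst G)"
  have inv: "dijkstra_inv ?V (set (snd G)) s ?V ((\<lambda>_. \<infinity>)(s := 0))"
    using assms(2) by (auto simp: dijkstra_inv_def intro!: exI[of _ "[]"])
  note loop = dijkstra_loop[where adj="result (adjacency G)" and xs="[0..<?N]" and N="?N",
      OF set_adjacency assms(3,2) finite_set _ _ inv]
  have card: "card ?V = length [0..<?N]" "length [0..<?N] \<le> ?N"
    using assms(1) by (simp_all add: distinct_card)
  show "shortest (set (snd G)) s v (result (dijkstra G s) v)"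
    using dijkstra_inv_empty loop[OF card, THEN conjunct1]
    by (simp add: dijkstra_unfold case_prod_beta del: fun_upd_apply)
  have "time (dijkstra G s) \<le> time (adjacency G) + (?N + 1) + ?N +
      (1 + ?N * (4 + ceillog2 ?N) + 2 * (\<Sum>a\<in>?V. length (result (adjacency G) a))) + 1"
    using loop[OF card, THEN conjunct2, THEN conjunct1]
    by (simp add: dijkstra_unfold case_prod_beta del: fun_upd_apply)
  then show "time (dijkstra G s) \<le> 7 * ?N + ?N * ceillog2 ?N + 4 * length (snd G) + 6"
    using time_adjacency_le[of G] sum_length_adjacency[of ?V G] by (simp add: algebra_simps)
  show "space (dijkstra G s) \<le> 3 * ?N + length (snd G)"
    using loop[OF card, THEN conjunct2, THEN conjunct2] space_adjacency_le[of G]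
    by (simp add: dijkstra_unfold case_prod_beta del: fun_upd_apply)
qed

section \<open>Distances in the reduced cost graph\<close>

lemma reduced:
  shows "fst (result (reduced \<pi> G)) = fst G"
    and "set (snd (result (reduced \<pi> G))) = (\<lambda>(a, b, w). (a, b, \<pi> a + w - \<pi> b)) ` set (snd G)"
    and "length (snd (result (reduced \<pi> G))) = length (snd G)"
    and "time (reduced \<pi> G) \<le> 2 * length (snd G) + 2"
    and "space (reduced \<pi> G) \<le> length (snd G)"
proof -
  let ?f = "\<lambda>(a, b, w) E. bind_cost (alloc 1) (\<lambda>_. return ((a, b, \<pi> a + w - \<pi> b) # E))"
  have "fold (\<lambda>x s. result (?f x s)) es E = rev (map (\<lambda>(a, b, w). (a, b, \<pi> a + w - \<pi> b)) es) @ E" for es E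
    by (induction es arbitrary: E) auto
  then have *: "result (reduced \<pi> G) = (fst G, rev (map (\<lambda>(a, b, w). (a, b, \<pi> a + w - \<pi> b)) (snd G)))"
    by (simp add: reduced_def result_for_each)
  show "fst (result (reduced \<pi> G)) = fst G"
    "set (snd (result (reduced \<pi> G))) = (\<lambda>(a, b, w). (a, b, \<pi> a + w - \<pi> b)) ` set (snd G)"
    "length (snd (result (reduced \<pi> G))) = length (snd G)"
    by (simp_all add: *)
  have "time (for_each (snd G) ?f []) \<le> 1 + length (snd G) * (1 + 1)"
    by (rule time_for_each_le) (auto split: prod.split)
  then show "time (reduced \<pi> G) \<le> 2 * length (snd G) + 2" by (simp add: reduced_def)
  have "space (for_each (snd G) ?f []) \<le> length (snd G) * 1"
    by (rule space_for_each_le) (auto split: prod.split)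
  then show "space (reduced \<pi> G) \<le> length (snd G)" by (simp add: reduced_def)
qed

lemma reversed:
  shows "fst (result (reversed G)) = fst G"
    and "set (snd (result (reversed G))) = (\<lambda>(a, b, w). (b, a, w)) ` set (snd G)"
    and "length (snd (result (reversed G))) = length (snd G)"
    and "time (reversed G) \<le> 2 * length (snd G) + 2"
    and "space (reversed G) \<le> length (snd G)"
proof -
  let ?f = "\<lambda>(a, b, w) E. bind_cost (alloc 1) (\<lambda>_. return ((b, a, w) # E))"
  have "fold (\<lambda>x s. result (?f x s)) es E = rev (map (\<lambda>(a, b, w). (b, a, w)) es) @ E"
    for es :: "'a edge list" and E
    by (induction es arbitrary: E) auto
  then have *: "result (reversed G) = (fst G, rev (map (\<lambda>(a, b, w). (b, a, w)) (snd G)))"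
    by (simp add: reversed_def result_for_each)
  show "fst (result (reversed G)) = fst G"
    "set (snd (result (reversed G))) = (\<lambda>(a, b, w). (b, a, w)) ` set (snd G)"
    "length (snd (result (reversed G))) = length (snd G)"
    by (simp_all add: *)
  have "time (for_each (snd G) ?f []) \<le> 1 + length (snd G) * (1 + 1)"
    by (rule time_for_each_le) (auto split: prod.split)
  then show "time (reversed G) \<le> 2 * length (snd G) + 2" by (simp add: reversed_def)
  have "space (for_each (snd G) ?f []) \<le> length (snd G) * 1"
    by (rule space_for_each_le) (auto split: prod.split)
  then show "space (reversed G) \<le> length (snd G)" by (simp add: reversed_def)
qed

section \<open>Transfer of shortest walks between a graph and its reduced and reversed
  versions\<close>

lemma reduced_walk:
  assumes "walk ((\<lambda>(a, b, w). (a, b, \<pi> a + w - \<pi> b)) ` E) u p v"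
  obtains q where "walk E u q v" "weight p = \<pi> u + weight q - \<pi> v"
proof -
  have "\<exists>q. walk E u q v \<and> weight p = \<pi> u + weight q - \<pi> v"
    using assms(1)
  proof (induction p arbitrary: u)
    case Nil
    then show ?case by (intro exI[of _ "[]"]) simp
  next
    case (Cons e p)
    obtain b d where e: "e = (u, b, d)" using Cons.prems by (cases e) auto
    with Cons.prems obtain w where w: "(u, b, w) \<in> E" "d = \<pi> u + w - \<pi> b" by auto
    obtain q where "walk E b q v" "weight p = \<pi> b + weight q - \<pi> v"
      using Cons e by auto
    then show ?case using w e by (intro exI[of _ "(u, b, w) # q"]) auto
  qed
  then show thesis using that by blast
qed

lemma walk_reduced:
  assumes "walk E u p v"
  obtains q where "walk ((\<lambda>(a, b, w). (a, b, \<pi> a + w - \<pi> b)) ` E) u q v"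
    "weight q = \<pi> u + weight p - \<pi> v"
proof -
  have "\<exists>q. walk ((\<lambda>(a, b, w). (a, b, \<pi> a + w - \<pi> b)) ` E) u q v \<and> weight q = \<pi> u + weight p - \<pi> v"
    using assms
  proof (induction p arbitrary: u)
    case Nil
    then show ?case by (intro exI[of _ "[]"]) simp
  next
    case (Cons e p)
    obtain a b w where e: "e = (a, b, w)" by (cases e)
    with Cons obtain q where "walk ((\<lambda>(a, b, w). (a, b, \<pi> a + w - \<pi> b)) ` E) b q v"
      "weight q = \<pi> b + weight p - \<pi> v" by auto
    then show ?case using e Cons.prems
      by (intro exI[of _ "(a, b, \<pi> a + w - \<pi> b) # q"]) force
  qed
  then show thesis using that by blast
qed

lemma shortest_reduced:
  assumes "shortest ((\<lambda>(a, b, w). (a, b, \<pi> a + w - \<pi> b)) ` E) u v z"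
  shows "shortest E u v (z + ereal (\<pi> v - \<pi> u))"
  unfolding shortest_def
proof (intro conjI allI impI)
  fix p assume "walk E u p v"
  then obtain q where "walk ((\<lambda>(a, b, w). (a, b, \<pi> a + w - \<pi> b)) ` E) u q v"
    and w: "weight q = \<pi> u + weight p - \<pi> v"
    by (rule walk_reduced)
  then have "z \<le> ereal (weight q)" using assms unfolding shortest_def by blast
  then show "z + ereal (\<pi> v - \<pi> u) \<le> ereal (weight p)"
    using w by (cases z) auto
next
  show "z + ereal (\<pi> v - \<pi> u) = \<infinity> \<or> (\<exists>p. walk E u p v \<and> z + ereal (\<pi> v - \<pi> u) = ereal (weight p))"
  proof (cases "z = \<infinity>")
    case False
    then obtain q where q: "walk ((\<lambda>(a, b, w). (a, b, \<pi> a + w - \<pi> b)) ` E) u q v" "z = ereal (weight q)"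
      using assms by (auto simp: shortest_def)
    from q(1) obtain p where "walk E u p v" "weight q = \<pi> u + weight p - \<pi> v"
      by (rule reduced_walk)
    then show ?thesis using q(2) by auto
  qed simp
qed

lemma walk_reversed:
  assumes "walk E u p v"
  obtains q where "walk ((\<lambda>(a, b, w). (b, a, w)) ` E) v q u" "weight q = weight p"
proof -
  have "\<exists>q. walk ((\<lambda>(a, b, w). (b, a, w)) ` E) v q u \<and> weight q = weight p"
    using assms
  proof (induction p arbitrary: u)
    case Nil
    then show ?case by (intro exI[of _ "[]"]) simp
  next
    case (Cons e p)
    obtain a b w where e: "e = (a, b, w)" by (cases e)
    with Cons obtain q where "walk ((\<lambda>(a, b, w). (b, a, w)) ` E) v q b" "weight q = weight p" by auto
    then show ?case using e Cons.prems
      by (intro exI[of _ "q @ [(b, a, w)]"]) (force simp: walk_append)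
  qed
  then show thesis using that by blast
qed

lemma shortest_reversed:
  assumes "shortest ((\<lambda>(a, b, w). (b, a, w)) ` E) v u z"
  shows "shortest E u v z"
proof -
  \<comment> \<open>As reversal is an involution, \<open>walk_reversed\<close> transfers walks in
    both directions.\<close>
  have "(\<lambda>(a, b, w). (b, a, w)) ` (\<lambda>(a, b, w). (b, a, w)) ` E = E"
    by (force simp: image_image)
  then show ?thesis
    using assms unfolding shortest_def by (metis walk_reversed)
qed

lemma dist_from:
  assumes "represents G V E" "valid_potential E \<pi>"
  shows "x \<in> V \<Longrightarrow> shortest E v x (result (dist_from G \<pi> v) x)"
    and "time (dist_from G \<pi> v) \<le>
      10 * length (fst G) + length (fst G) * ceillog2 (length (fst G)) + 6 * length (snd G) + 10"
    and "space (dist_from G \<pi> v) \<le> 4 * length (fst G) + 2 * length (snd G)"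
proof -
  let ?R = "result (reduced \<pi> G)" and ?T = "\<lambda>D. tabulate (fst G) (\<lambda>x. D x + ereal (\<pi> x - \<pi> v))"
  have R: "distinct (fst ?R)" "set (snd ?R) \<subseteq> set (fst ?R) \<times> set (fst ?R) \<times> UNIV"
    "\<forall>(a, b, w)\<in>set (snd ?R). 0 \<le> w"
    using assms by (auto simp: represents_def reduced valid_potential_def)
  show "shortest E v x (result (dist_from G \<pi> v) x)" if "x \<in> V"
    using shortest_reduced[of \<pi> E v x] dijkstra(1)[OF R, of v x] that assms(1)
    by (auto simp: dist_from_def result_tabulate reduced represents_def)
  show "time (dist_from G \<pi> v) \<le>
      10 * length (fst G) + length (fst G) * ceillog2 (length (fst G)) + 6 * length (snd G) + 10"
    using reduced(4)[of \<pi> G] dijkstra(2)[OF R, of v]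
      time_tabulate_le[of "fst G" "\<lambda>x. result (dijkstra ?R v) x + ereal (\<pi> x - \<pi> v)"]
    by (simp add: dist_from_def reduced(1-3))
  show "space (dist_from G \<pi> v) \<le> 4 * length (fst G) + 2 * length (snd G)"
    using reduced(5)[of \<pi> G] dijkstra(3)[OF R, of v]
      space_tabulate_le[of "fst G" "\<lambda>x. result (dijkstra ?R v) x + ereal (\<pi> x - \<pi> v)"]
    by (simp add: dist_from_def reduced(1-3))
qed

lemma dist_to:
  assumes "represents G V E" "valid_potential E \<pi>"
  shows "x \<in> V \<Longrightarrow> shortest E x u (result (dist_to G \<pi> u) x)"
    and "time (dist_to G \<pi> u) \<le>
      10 * length (fst G) + length (fst G) * ceillog2 (length (fst G)) + 8 * length (snd G) + 12"
    and "space (dist_to G \<pi> u) \<le> 4 * length (fst G) + 3 * length (snd G)"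
proof -
  let ?R = "result (reduced \<pi> G)"
  let ?R' = "result (reversed ?R)"
  have R: "distinct (fst ?R')" "set (snd ?R') \<subseteq> set (fst ?R') \<times> set (fst ?R') \<times> UNIV"
    "\<forall>(a, b, w)\<in>set (snd ?R'). 0 \<le> w"
    using assms by (auto simp: represents_def reduced reversed valid_potential_def)
  show "shortest E x u (result (dist_to G \<pi> u) x)" if "x \<in> V"
    using shortest_reduced[OF shortest_reversed, of \<pi> E u x] dijkstra(1)[OF R, of u x] that assms(1)
    by (auto simp: dist_to_def result_tabulate reduced reversed represents_def)
  show "time (dist_to G \<pi> u) \<le>
      10 * length (fst G) + length (fst G) * ceillog2 (length (fst G)) + 8 * length (snd G) + 12"
    using reduced(4)[of \<pi> G] reversed(4)[of ?R] dijkstra(2)[OF R, of u]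
      time_tabulate_le[of "fst G" "\<lambda>x. result (dijkstra ?R' u) x + ereal (\<pi> u - \<pi> x)"]
    by (simp add: dist_to_def reduced(1-3) reversed(1-3))
  show "space (dist_to G \<pi> u) \<le> 4 * length (fst G) + 3 * length (snd G)"
    using reduced(5)[of \<pi> G] reversed(5)[of ?R] dijkstra(3)[OF R, of u]
      space_tabulate_le[of "fst G" "\<lambda>x. result (dijkstra ?R' u) x + ereal (\<pi> u - \<pi> x)"]
    by (simp add: dist_to_def reduced(1-3) reversed(1-3))
qed

section \<open>The algorithm\<close>

lemma answer_cases: "r = UNSAT \<or> (\<exists>a b. r = Answer (a, b))"
  by (cases r) auto

text \<open>Naming the constant allows raising it to a nonnegative one, on which the monotonicity of
  the cost estimates depends.\<close>

definition inc_con_diff_with :: "real \<Rightarrow> 'a inc_alg \<Rightarrow> bool" where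
  "inc_con_diff_with K inc \<longleftrightarrow> (\<forall>G V E \<pi> u v d.
     represents G V E \<and> valid_potential E \<pi> \<and> u \<in> V \<and> v \<in> V \<longrightarrow>
       (neg_cycle (insert (u, v, d) E) \<longrightarrow> result (inc G \<pi> (u, v, d)) = UNSAT) \<and>
       (\<not> neg_cycle (insert (u, v, d) E) \<longrightarrow> (\<exists>G' \<pi>'. result (inc G \<pi> (u, v, d)) = Answer (G', \<pi>') \<and>
          represents G' V (insert (u, v, d) E) \<and> valid_potential (insert (u, v, d) E) \<pi>')) \<and>
       time (inc G \<pi> (u, v, d)) \<le> K * (real (card V) * log 2 (real (card V)) + real (card E) + 1) \<and>
       space (inc G \<pi> (u, v, d)) \<le> K * (real (card V) + real (card E) + 1))"

lemma inc_con_diff_iff: "inc_con_diff inc \<longleftrightarrow> (\<exists>K. inc_con_diff_with K inc)"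
  by (simp add: inc_con_diff_def inc_con_diff_with_def Let_def)

lemma nlogn_nonneg: "0 \<le> real n * log 2 (real n)"
  by (cases "n = 0") auto

lemma inc_con_diff_with_mono:
  assumes "inc_con_diff_with K inc" "K \<le> K'"
  shows "inc_con_diff_with K' inc"
proof -
  have "K * (real a * log 2 (real a) + real b + 1) \<le> K' * (real a * log 2 (real a) + real b + 1)" for a b
    using assms(2) nlogn_nonneg[of a] by (intro mult_right_mono) auto
  moreover have "K * (real a + real b + 1) \<le> K' * (real a + real b + 1)" for a b
    using assms(2) by (intro mult_right_mono) auto
  ultimately show ?thesis
    using assms(1) unfolding inc_con_diff_with_def by (meson order_trans)
qed

text \<open>\<open>M\<close> bounds the number of edges of all intermediate graphs, so every call of
  the subroutine has the same cost bound. A negative cycle found early persists in the full graph,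
  which makes an early UNSAT correct.\<close>

lemma add_edges:
  fixes t s :: real
  assumes inc: "inc_con_diff_with K inc"
    and K: "0 \<le> K" and "represents G V E" "valid_potential E \<pi>"
    and "set es \<subseteq> V \<times> V \<times> UNIV" "card E + length es \<le> M"
  defines "t \<equiv> K * (real (card V) * log 2 (real (card V)) + real M + 1)"
    and "s \<equiv> K * (real (card V) + real M + 1)"
  shows "(result (add_edges inc es G \<pi>) = UNSAT \<longrightarrow> neg_cycle (E \<union> set es)) \<and>
    (\<forall>G' \<pi>'. result (add_edges inc es G \<pi>) = Answer (G', \<pi>') \<longrightarrow>
      represents G' V (E \<union> set es) \<and> valid_potential (E \<union> set es) \<pi>') \<and>
    time (add_edges inc es G \<pi>) \<le> 1 + length es * (2 + t) \<and>
    space (add_edges inc es G \<pi>) \<le> length es * s"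
  using assms(3-6)
proof (induction es arbitrary: G \<pi> E)
  case Nil
  then show ?case by simp
next
  case (Cons e es)
  obtain u v d where e: "e = (u, v, d)" by (cases e)
  let ?E = "insert (u, v, d) E" and ?r = "inc G \<pi> (u, v, d)"
  have uv: "u \<in> V" "v \<in> V" using Cons.prems e by auto
  note inc = inc[unfolded inc_con_diff_with_def, rule_format, OF conjI[OF Cons.prems(1) conjI[OF Cons.prems(2) conjI[OF uv]]], of d]
  have "time ?r \<le> K * (real (card V) * log 2 (real (card V)) + real (card E) + 1)" using inc by blast
  also have "\<dots> \<le> t" unfolding t_def using Cons.prems K by (intro mult_left_mono) auto
  finally have t: "time ?r \<le> t" .
  have "space ?r \<le> K * (real (card V) + real (card E) + 1)" using inc by blast
  also have "\<dots> \<le> s" unfolding s_def using Cons.prems K by (intro mult_left_mono) auto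
  finally have s: "space ?r \<le> s" .
  have "0 \<le> t" "0 \<le> s" unfolding t_def s_def using K nlogn_nonneg[of "card V"] by auto
  \<comment> \<open>The budget of the remaining edges, which is left over when the run stops
    early.\<close>
  then have "0 \<le> length es * (2 + t)" "0 \<le> length es * s" by auto
  show ?case
  proof (cases "neg_cycle ?E")
    case True
    then have r: "result ?r = UNSAT" using inc by blast
    have "neg_cycle (E \<union> set (e # es))"
      using True unfolding neg_cycle_def e by (auto dest: walk_mono[where F="insert (u, v, d) (E \<union> set es)"])
    moreover have "time (add_edges inc (e # es) G \<pi>) = 2 + time ?r"
      "space (add_edges inc (e # es) G \<pi>) = space ?r" "result (add_edges inc (e # es) G \<pi>) = UNSAT"
      using r by (simp_all add: e)
    moreover have "length (e # es) * (2 + t) = 2 + t + length es * (2 + t)"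
      "length (e # es) * s = s + length es * s"
      by (simp_all add: algebra_simps)
    ultimately show ?thesis using t s \<open>0 \<le> length es * (2 + t)\<close> \<open>0 \<le> length es * s\<close>
      by (simp del: length_Cons zero_le_mult_iff mult_nonneg_nonneg)
  next
    case False
    then obtain G' \<pi>' where r: "result ?r = Answer (G', \<pi>')" "represents G' V ?E" "valid_potential ?E \<pi>'"
      using inc by blast
    have "card ?E \<le> card E + 1" by (simp add: card_insert_le_m1 card_insert_if)
    then have "card ?E + length es \<le> M" using Cons.prems by simp
    from Cons.IH[OF r(2,3) _ this] Cons.prems(3) have IH:
      "result (add_edges inc es G' \<pi>') = UNSAT \<longrightarrow> neg_cycle (?E \<union> set es)"
      "\<forall>G'' \<pi>''. result (add_edges inc es G' \<pi>') = Answer (G'', \<pi>'') \<longrightarrow>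
        represents G'' V (?E \<union> set es) \<and> valid_potential (?E \<union> set es) \<pi>''"
      "time (add_edges inc es G' \<pi>') \<le> 1 + length es * (2 + t)"
      "space (add_edges inc es G' \<pi>') \<le> length es * s"
      by auto
    have "?E \<union> set es = E \<union> set (e # es)" using e by auto
    then show ?thesis using IH r(1) t s by (simp add: e algebra_simps)
  qed
qed

lemma wSP_dist_from:
  assumes "represents G V E" "valid_potential E \<pi>" "x \<in> V"
  shows "result (dist_from G \<pi> v) x = wSP E v x"
  using wSP_eqI[OF dist_from(1)[OF assms]] by simp

lemma wSP_dist_to:
  assumes "represents G V E" "valid_potential E \<pi>" "x \<in> V"
  shows "result (dist_to G \<pi> u) x = wSP E x u"
  using wSP_eqI[OF dist_to(1)[OF assms]] by simp

lemma opp_in_vertices [simp]: "opp x \<in> vertices X \<longleftrightarrow> x \<in> vertices X"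
  by (simp add: mem_vertices)

lemma edges_of_in_vertices:
  "vars c \<subseteq> X \<Longrightarrow> set (edges_of c) \<subseteq> vertices X \<times> vertices X \<times> UNIV"
  using edges_of_shape(4,5) by (fastforce simp: mem_vertices)

lemma satisfiable_iff_bounds:
  assumes X: "finite X" "\<forall>c\<in>\<phi>. vars c \<subseteq> X" and pot: "valid_potential (constraint_graph \<phi>) \<pi>"
  shows "satisfiable \<phi> \<longleftrightarrow> (\<forall>u\<in>vertices X. 0 \<le> bounds \<phi> u + bounds \<phi> (opp u))"
proof
  assume "satisfiable \<phi>"
  then show "\<forall>u\<in>vertices X. 0 \<le> bounds \<phi> u + bounds \<phi> (opp u)"
    unfolding bounds_nonneg_iff[OF pot] using satisfiable_consistent by blast
next
  assume *: "\<forall>u\<in>vertices X. 0 \<le> bounds \<phi> u + bounds \<phi> (opp u)"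
  show "satisfiable \<phi>"
  proof (rule satisfiable_if_consistent[OF X pot])
    fix u j k
    assume jk: "bound_le (constraint_graph \<phi>) u j" "bound_le (constraint_graph \<phi>) (opp u) k"
    \<comment> \<open>The algorithm tests only vertices over \<open>X\<close>, whereas consistency
      concerns every \<open>u\<close>. As \<open>u\<close> differs from \<open>opp u\<close>, a walk
      between them has a first edge, and this places \<open>u\<close> over \<open>X\<close>.\<close>
    obtain p where p: "walk (constraint_graph \<phi>) u p (opp u)"
      using jk(1) by (auto simp: bound_le_def dist_le_def)
    then obtain e p' where "p = e # p'" by (cases p) auto
    then obtain v d where "(u, v, d) \<in> constraint_graph \<phi>" using p by (cases e) auto
    then obtain c where "c \<in> \<phi>" "(u, v, d) \<in> set (edges_of c)" by (auto simp: constraint_graph_def)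
    then have "u \<in> vertices X" using edges_of_shape(4) X(2) unfolding mem_vertices by fast
    with * have "0 \<le> bounds \<phi> u + bounds \<phi> (opp u)" by (rule bspec)
    then show "0 \<le> j + k" unfolding bounds_nonneg_iff[OF pot] using jk by blast
  qed
qed

lemma for_each_disj:
  "result (for_each xs (\<lambda>x b. return (b \<or> Q x)) b) \<longleftrightarrow> b \<or> (\<exists>x\<in>set xs. Q x)"
  by (induction xs arbitrary: b) auto

lemma for_each_filter:
  assumes "\<And>x ys. result (f x ys) = (if Q x then x # ys else ys)"
  shows "result (for_each xs f ys) = rev (filter Q xs) @ ys"
  by (induction xs arbitrary: ys) (auto simp: assms)

section \<open>The stages of the algorithm after the edges have been inserted\<close>

definition scst_filter where
  "scst_filter \<delta>to d \<delta>from \<rho> P = for_each P (\<lambda>c' P'.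
    let (x, y, d') = hd (edges_of c') in
    if \<delta>to x + ereal d + \<delta>from y > ereal d' \<and>
       \<delta>to (opp y) + ereal d + \<delta>from (opp x) > ereal d' \<and>
       \<rho> x + \<rho> (opp y) > ereal d'
    then bind_cost (alloc 1) (\<lambda>_. return (c' # P'))
    else return P') []"

lemma result_scst_filter:
  "result (scst_filter \<delta>to d \<delta>from \<rho> P) = rev (filter (\<lambda>c'.
    let (x, y, d') = hd (edges_of c') in \<delta>to x + ereal d + \<delta>from y > ereal d' \<and>
       \<delta>to (opp y) + ereal d + \<delta>from (opp x) > ereal d' \<and> \<rho> x + \<rho> (opp y) > ereal d') P)"
  unfolding scst_filter_def by (subst for_each_filter) (auto simp: Let_def split: prod.split)

lemma cost_scst_filter:
  "time (scst_filter \<delta>to d \<delta>from \<rho> P) \<le> 1 + 2 * length P"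
  "space (scst_filter \<delta>to d \<delta>from \<rho> P) \<le> length P"
proof -
  have "time (scst_filter \<delta>to d \<delta>from \<rho> P) \<le> 1 + length P * (1 + 1)"
    unfolding scst_filter_def by (rule time_for_each_le) (auto simp: Let_def split: prod.split)
  then show "time (scst_filter \<delta>to d \<delta>from \<rho> P) \<le> 1 + 2 * length P" by simp
  have "space (scst_filter \<delta>to d \<delta>from \<rho> P) \<le> length P * 1"
    unfolding scst_filter_def by (rule space_for_each_le) (auto simp: Let_def split: prod.split)
  then show "space (scst_filter \<delta>to d \<delta>from \<rho> P) \<le> length P" by simp
qed

definition scst_bounds where
  "scst_bounds V \<rho> \<delta>to d \<delta>from = tabulate V
     (\<lambda>x. min (\<rho> x) (efloor ((\<delta>to x + ereal d + \<delta>from (opp x)) / 2)))"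

definition scst_conflict :: "'v vertex list \<Rightarrow> ('v vertex \<Rightarrow> ereal) \<Rightarrow> bool cost" where
  "scst_conflict V \<rho> = for_each V (\<lambda>x b. return (b \<or> \<rho> x + \<rho> (opp x) < 0)) False"

lemma scst_conflict:
  "result (scst_conflict V \<rho>) \<longleftrightarrow> (\<exists>x\<in>set V. \<rho> x + \<rho> (opp x) < 0)"
  "time (scst_conflict V \<rho>) \<le> 1 + 2 * length V" "space (scst_conflict V \<rho>) = 0"
  using time_for_each_le[of "\<lambda>x b. return (b \<or> \<rho> x + \<rho> (opp x) < 0)" 1 V False]
    space_for_each_le[of "\<lambda>x b. return (b \<or> \<rho> x + \<rho> (opp x) < 0)" 0 V False]
  by (simp_all add: scst_conflict_def for_each_disj)

definition scst_update where
  "scst_update G \<pi> e \<rho> P = (let (u, v, d) = e in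
     bind_cost (dist_to G \<pi> u) (\<lambda>\<delta>to. bind_cost (dist_from G \<pi> v) (\<lambda>\<delta>from.
     bind_cost (scst_bounds (fst G) \<rho> \<delta>to d \<delta>from) (\<lambda>\<rho>'.
     bind_cost (scst_conflict (fst G) \<rho>') (\<lambda>conflict.
     if conflict then return UNSAT
     else bind_cost (scst_filter \<delta>to d \<delta>from \<rho>' P) (\<lambda>P'. return (Answer (G, \<pi>, \<rho>', P'))))))))"

lemma scst_unfold:
  "scst inc order pick G \<pi> \<rho> P c =
    bind_cost (alloc (3 * length (fst G) + length (snd G) + length P)) (\<lambda>_.
    bind_cost (add_edges inc (order c) G \<pi>) (\<lambda>r. case r of UNSAT \<Rightarrow> return UNSAT
      | Answer (G', \<pi>') \<Rightarrow> scst_update G' \<pi>' (pick c) \<rho> P))"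
  unfolding scst_def scst_update_def scst_filter_def scst_bounds_def scst_conflict_def ..

text \<open>The 25 per vertex adds 10 for each of the two distance computations, 3 for the new
  bounds and 2 for the conflict test. The 14 per edge splits into 8 for distances to
  \<open>u\<close>, which need a reversed graph, and 6 for distances from \<open>v\<close>.\<close>

lemma cost_scst_update:
  assumes "represents G V E" "valid_potential E \<pi>"
  shows "time (scst_update G \<pi> e \<rho> P) \<le> 25 * card V + 2 * card V * ceillog2 (card V) +
      14 * card E + 2 * length P + 28"
    and "space (scst_update G \<pi> e \<rho> P) \<le> 9 * card V + 5 * card E + length P"
proof -
  obtain u v d where e: "e = (u, v, d)" by (cases e)
  have [simp]: "length (fst G) = card V" "length (snd G) = card E"
    using assms(1) distinct_card by (force simp: represents_def)+
  let ?to = "result (dist_to G \<pi> u)" and ?from = "result (dist_from G \<pi> v)"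
  let ?\<rho> = "scst_bounds (fst G) \<rho> ?to d ?from"
  have \<rho>: "time ?\<rho> \<le> 3 * card V + 2" "space ?\<rho> \<le> card V"
    unfolding scst_bounds_def using time_tabulate_le[of "fst G"] space_tabulate_le[of "fst G"] by simp_all
  note costs = dist_to(2,3)[OF assms, of u] dist_from(2,3)[OF assms, of v] \<rho>
    scst_conflict(2,3)[of "fst G" "result ?\<rho>"]
    cost_scst_filter[of ?to d ?from "result ?\<rho>" P]
  show "time (scst_update G \<pi> e \<rho> P) \<le> 25 * card V + 2 * card V * ceillog2 (card V) +
      14 * card E + 2 * length P + 28"
    using costs by (simp add: scst_update_def e)
  show "space (scst_update G \<pi> e \<rho> P) \<le> 9 * card V + 5 * card E + length P"
    using costs by (simp add: scst_update_def e)
qed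

text \<open>The insertion of the edges has only excluded negative cycles, so \<open>\<phi>'\<close>
  may still be unsatisfiable over the integers. The conflict test on the new bounds decides
  this.\<close>

lemma result_scst_update:
  fixes c :: "'v utvpi" and \<phi> :: "'v utvpi set"
  defines "\<phi>' \<equiv> insert c \<phi>"
  assumes X: "finite X" "\<forall>c'\<in>\<phi>'. vars c' \<subseteq> X"
    and P: "distinct P" "\<forall>c'\<in>set P. vars c' \<subseteq> X" "\<forall>c'\<in>set P. \<not> entails \<phi> c'"
    and G: "represents G (vertices X) (constraint_graph \<phi>')"
    and pot: "valid_potential (constraint_graph \<phi>') \<pi>"
    and \<rho>: "\<forall>u\<in>vertices X. \<rho> u = bounds \<phi> u"
    and e: "e \<in> set (edges_of c)"
  shows "\<not> satisfiable \<phi>' \<Longrightarrow> result (scst_update G \<pi> e \<rho> P) = UNSAT"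
    and "satisfiable \<phi>' \<Longrightarrow> \<exists>\<rho>' P'. result (scst_update G \<pi> e \<rho> P) = Answer (G, \<pi>, \<rho>', P') \<and>
      (\<forall>u\<in>vertices X. \<rho>' u = bounds \<phi>' u) \<and> distinct P' \<and> set P' = {c'\<in>set P. \<not> entails \<phi>' c'}"
proof -
  obtain u v d where uvd: "e = (u, v, d)" by (cases e)
  note e = e[unfolded uvd]
  define G' where "G' = constraint_graph \<phi>'"
  define to where "to = result (dist_to G \<pi> u)"
  define from' where "from' = result (dist_from G \<pi> v)"
  define \<rho>' where "\<rho>' = result (scst_bounds (fst G) \<rho> to d from')"
  have V: "set (fst G) = vertices X" using G by (simp add: represents_def)
  have to: "to x = wSP G' x u" and "from": "from' x = wSP G' v x" if "x \<in> vertices X" for x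
    using wSP_dist_to[OF G pot that] wSP_dist_from[OF G pot that] by (simp_all add: to_def from'_def G'_def)
  have \<rho>': "\<rho>' x = bounds \<phi>' x" if "x \<in> vertices X" for x
    using that bounds_insert[OF e pot[unfolded \<phi>'_def], of x]
    by (simp add: \<rho>'_def scst_bounds_def result_tabulate V \<rho> to "from" G'_def \<phi>'_def)
  have conflict: "result (scst_conflict (fst G) \<rho>') \<longleftrightarrow> \<not> satisfiable \<phi>'"
    unfolding satisfiable_iff_bounds[OF X pot] scst_conflict V by (auto simp: \<rho>' not_le)
  show "result (scst_update G \<pi> e \<rho> P) = UNSAT" if "\<not> satisfiable \<phi>'"
    using conflict that by (simp add: scst_update_def uvd flip: to_def from'_def \<rho>'_def)
  assume sat: "satisfiable \<phi>'"
  define P' where "P' = result (scst_filter to d from' \<rho>' P)"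
  have "result (scst_update G \<pi> e \<rho> P) = Answer (G, \<pi>, \<rho>', P')"
    using conflict sat by (simp add: scst_update_def uvd flip: to_def from'_def \<rho>'_def P'_def)
  moreover have "distinct P'" using P(1) by (simp add: P'_def result_scst_filter)
  moreover have "(let (x, y, d') = hd (edges_of c') in ereal d' < to x + ereal d + from' y \<and>
       ereal d' < to (opp y) + ereal d + from' (opp x) \<and> ereal d' < \<rho>' x + \<rho>' (opp y)) \<longleftrightarrow>
     \<not> entails \<phi>' c'" if c': "c' \<in> set P" for c'
  proof -
    obtain x y d' where hd: "hd (edges_of c') = (x, y, d')" by (cases "hd (edges_of c')")
    then have e': "(x, y, d') \<in> set (edges_of c')"
      using edges_of_nonempty by (metis list.set_sel(1))
    then have xy: "x \<in> vertices X" "y \<in> vertices X"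
      using edges_of_in_vertices[OF P(2)[rule_format, OF c']] by auto
    show ?thesis
      using entails_insert_iff[OF X(1) X(2)[unfolded \<phi>'_def] P(2)[rule_format, OF c'] sat[unfolded \<phi>'_def] e e' P(3)[rule_format, OF c']] xy
      by (simp add: hd to "from" \<rho>' G'_def \<phi>'_def)
  qed
  then have "set P' = {c'\<in>set P. \<not> entails \<phi>' c'}"
    unfolding P'_def result_scst_filter set_rev set_filter by blast
  ultimately show "\<exists>\<rho>' P'. result (scst_update G \<pi> e \<rho> P) = Answer (G, \<pi>, \<rho>', P') \<and>
      (\<forall>u\<in>vertices X. \<rho>' u = bounds \<phi>' u) \<and> distinct P' \<and> set P' = {c'\<in>set P. \<not> entails \<phi>' c'}"
    using \<rho>' by blast
qed

section \<open>Graph sizes in terms of variables and constraints\<close>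

lemma card_vertices: "finite X \<Longrightarrow> card (vertices X) = 2 * card X"
  unfolding vertices_def by (subst card_Un_disjoint) (auto simp: card_image inj_on_def)

lemma card_edges_of: "card (set (edges_of c)) \<le> 2"
  by (rule order_trans[OF card_length]) (cases c; simp)

lemma card_constraint_graph: "finite \<phi> \<Longrightarrow> card (constraint_graph \<phi>) \<le> 2 * card \<phi>"
proof -
  assume "finite \<phi>"
  then have "card (constraint_graph \<phi>) \<le> (\<Sum>c\<in>\<phi>. card (set (edges_of c)))"
    unfolding constraint_graph_def by (rule card_UN_le)
  also have "\<dots> \<le> of_nat (card \<phi>) * 2" by (intro sum_bounded_above card_edges_of)
  finally show "card (constraint_graph \<phi>) \<le> 2 * card \<phi>" by simp
qed

text \<open>Absorbs terms linear in \<open>n\<close>; the summand 1 covers \<open>n = 1\<close>,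
  where the logarithm vanishes.\<close>

lemma le_nlogn: "real n \<le> real n * log 2 n + 1"
proof (cases "n \<le> 1")
  case True
  then have "n = 0 \<or> n = 1" by auto
  then show ?thesis by auto
next
  case False
  then have "1 \<le> log 2 (real n)" by simp
  then have "real n * 1 \<le> real n * log 2 (real n)" by (intro mult_left_mono) auto
  then show ?thesis by simp
qed

text \<open>There are two vertices per variable. Doubling adds 1 to the logarithm and rounding up
  less than 1 more, which leaves terms linear in \<open>n\<close> for \<open>le_nlogn\<close> to
  absorb.\<close>

lemma double_nlogn:
  assumes "1 \<le> n"
  shows "real (2 * n) * log 2 (2 * n) \<le> 4 * (real n * log 2 n + 1)"
    and "real (2 * n) * ceillog2 (2 * n) \<le> 6 * (real n * log 2 n + 1)"
proof -
  have log: "log 2 (real (2 * n)) = 1 + log 2 (real n)"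
    using assms by (simp add: log_mult)
  have nonneg: "0 \<le> real n * log 2 (real n)" using assms by simp
  have "real (2 * n) * log 2 (2 * n) = 2 * real n + 2 * (real n * log 2 n)"
    using log by (simp add: algebra_simps)
  then show "real (2 * n) * log 2 (2 * n) \<le> 4 * (real n * log 2 n + 1)"
    using le_nlogn[of n] nonneg by simp
  have "real (ceillog2 (2 * n)) \<le> 2 + log 2 (real n)"
    using ceillog2_less_log[of "2 * n"] assms log by simp
  then have "real (2 * n) * ceillog2 (2 * n) \<le> real (2 * n) * (2 + log 2 (real n))"
    by (intro mult_left_mono) auto
  also have "\<dots> = 4 * real n + 2 * (real n * log 2 n)" by (simp add: algebra_simps)
  finally show "real (2 * n) * ceillog2 (2 * n) \<le> 6 * (real n * log 2 n + 1)"
    using le_nlogn[of n] nonneg by simp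
qed

lemma scst_correct_and_efficient:
  fixes c :: "'v utvpi" and \<phi> P X and K n m p :: real
  assumes inc: "inc_con_diff_with K inc"
    and K: "0 \<le> K"
    and fin: "finite X" "finite \<phi>"
    and vars: "\<forall>c'\<in>\<phi> \<union> set P \<union> {c}. vars c' \<subseteq> X"
    and G: "represents G (vertices X) (constraint_graph \<phi>)"
    and pot: "valid_potential (constraint_graph \<phi>) \<pi>"
    and \<rho>: "\<forall>u\<in>vertices X. \<rho> u = bounds \<phi> u"
    and P: "distinct P" "\<forall>c'\<in>set P. \<not> entails \<phi> c'"
    and order: "distinct (order c)" "set (order c) = set (edges_of c)" and pick: "pick c \<in> set (edges_of c)"
  defines "r \<equiv> scst inc order pick G \<pi> \<rho> P c" and "\<phi>' \<equiv> insert c \<phi>"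
    and "n \<equiv> real (card X)" and "m \<equiv> real (card \<phi>)" and "p \<equiv> real (card (set P))"
  shows "\<not> satisfiable \<phi>' \<Longrightarrow> result r = UNSAT"
    and "satisfiable \<phi>' \<Longrightarrow> \<exists>G' \<pi>' \<rho>' P'. result r = Answer (G', \<pi>', \<rho>', P') \<and>
           represents G' (vertices X) (constraint_graph \<phi>') \<and>
           valid_potential (constraint_graph \<phi>') \<pi>' \<and>
           (\<forall>u\<in>vertices X. \<rho>' u = bounds \<phi>' u) \<and>
           distinct P' \<and> set P' = {c'\<in>set P. \<not> entails \<phi>' c'}"
    and "time r \<le> (150 + 14 * K) * (n * log 2 n + m + p + 1)"
    and "space r \<le> (50 + 14 * K) * (n + m + p)"
proof -
  define r1 where "r1 = add_edges inc (order c) G \<pi>"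
  have E': "constraint_graph \<phi> \<union> set (order c) = constraint_graph \<phi>'"
    using order by (auto simp: constraint_graph_def \<phi>'_def)
  have len: "length (order c) \<le> 2"
    using card_edges_of[of c] distinct_card[OF order(1)] order(2) by simp
  have in_V: "set (order c) \<subseteq> vertices X \<times> vertices X \<times> UNIV"
    using edges_of_in_vertices[of c X] vars order by simp
  \<comment> \<open>Each constraint of \<phi> contributes at most two edges, and \<open>c\<close>
    adds at most two more.\<close>
  let ?M = "2 * card \<phi> + 2"
  have M: "card (constraint_graph \<phi>) + length (order c) \<le> ?M"
    using card_constraint_graph[OF fin(2)] len by simp
  note add = add_edges[where inc=inc, OF inc K G pot in_V M, folded r1_def, unfolded E']
  have vars': "\<forall>c'\<in>\<phi>'. vars c' \<subseteq> X" "\<forall>c'\<in>set P. vars c' \<subseteq> X" using vars by (auto simp: \<phi>'_def)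
  have unsat: "\<not> satisfiable \<phi>'" if "result r1 = UNSAT"
  proof
    assume "satisfiable \<phi>'"
    then obtain \<sigma> where "\<forall>c\<in>\<phi>'. holds \<sigma> c" by (auto simp: satisfiable_def)
    from valid_potential_no_neg_cycle[OF valid_potential_lit[OF this]] show False
      using add that by blast
  qed
  have update: "represents G' (vertices X) (constraint_graph \<phi>')" "valid_potential (constraint_graph \<phi>') \<pi>'"
    "\<not> satisfiable \<phi>' \<Longrightarrow> result (scst_update G' \<pi>' (pick c) \<rho> P) = UNSAT"
    "satisfiable \<phi>' \<Longrightarrow> \<exists>\<rho>' P'. result (scst_update G' \<pi>' (pick c) \<rho> P) = Answer (G', \<pi>', \<rho>', P') \<and>
      (\<forall>u\<in>vertices X. \<rho>' u = bounds \<phi>' u) \<and> distinct P' \<and> set P' = {c'\<in>set P. \<not> entails \<phi>' c'}"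
    if r1: "result r1 = Answer (G', \<pi>')" for G' \<pi>'
  proof -
    show G': "represents G' (vertices X) (constraint_graph \<phi>')" "valid_potential (constraint_graph \<phi>') \<pi>'"
      using add r1 by blast+
    note result = result_scst_update[where \<phi>=\<phi> and c=c and X=X and P=P and G=G' and \<pi>=\<pi>' and \<rho>=\<rho> and e="pick c",
      folded \<phi>'_def, OF fin(1) vars'(1) P(1) vars'(2) P(2) G' \<rho> pick]
    show "result (scst_update G' \<pi>' (pick c) \<rho> P) = UNSAT" if "\<not> satisfiable \<phi>'"
      using that by (rule result(1))
    show "\<exists>\<rho>' P'. result (scst_update G' \<pi>' (pick c) \<rho> P) = Answer (G', \<pi>', \<rho>', P') \<and>
        (\<forall>u\<in>vertices X. \<rho>' u = bounds \<phi>' u) \<and> distinct P' \<and> set P' = {c'\<in>set P. \<not> entails \<phi>' c'}"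
      if "satisfiable \<phi>'"
      using that by (rule result(2))
  qed
  have result_r: "result r = (case result r1 of UNSAT \<Rightarrow> UNSAT
      | Answer (G', \<pi>') \<Rightarrow> result (scst_update G' \<pi>' (pick c) \<rho> P))"
    by (simp add: r_def scst_unfold r1_def split: answer.split)
  show "\<not> satisfiable \<phi>' \<Longrightarrow> result r = UNSAT"
    using answer_cases[of "result r1"] update(3) unfolding result_r by fastforce
  show "satisfiable \<phi>' \<Longrightarrow> \<exists>G' \<pi>' \<rho>' P'. result r = Answer (G', \<pi>', \<rho>', P') \<and>
           represents G' (vertices X) (constraint_graph \<phi>') \<and>
           valid_potential (constraint_graph \<phi>') \<pi>' \<and>
           (\<forall>u\<in>vertices X. \<rho>' u = bounds \<phi>' u) \<and>
           distinct P' \<and> set P' = {c'\<in>set P. \<not> entails \<phi>' c'}"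
  proof -
    assume sat: "satisfiable \<phi>'"
    then obtain G' \<pi>' where r1: "result r1 = Answer (G', \<pi>')" using answer_cases[of "result r1"] unsat by blast
    from update(4)[OF r1 sat] obtain \<rho>' P' where
      "result (scst_update G' \<pi>' (pick c) \<rho> P) = Answer (G', \<pi>', \<rho>', P')"
      "\<forall>u\<in>vertices X. \<rho>' u = bounds \<phi>' u" "distinct P'" "set P' = {c'\<in>set P. \<not> entails \<phi>' c'}"
      by (elim exE conjE)
    then show ?thesis
      using update(1,2)[OF r1]
      by (intro exI[of _ G'] exI[of _ \<pi>'] exI[of _ \<rho>'] exI[of _ P'] conjI) (simp_all add: result_r r1)
  qed
  \<comment> \<open>The constraint \<open>c\<close> mentions a variable, so \<open>n\<close> is at
    least 1. This lets the space bound do without an additive constant.\<close>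
  obtain u v d where "(u, v, d) \<in> set (edges_of c)" using pick by (metis prod_cases3)
  then have "X \<noteq> {}" using edges_of_shape(4) vars by blast
  then have n: "1 \<le> card X" using fin by (simp add: Suc_leI card_gt_0_iff)
  let ?V = "2 * card X"
  have V: "length (fst G) = ?V" "length (snd G) \<le> ?M" "length P = card (set P)"
    using G card_constraint_graph[OF fin(2)] distinct_card[of "fst G"] distinct_card[of "snd G"]
      distinct_card[OF P(1)] card_vertices[OF fin(1)] by (auto simp: represents_def)
  have m': "card (constraint_graph \<phi>') \<le> ?M"
    using card_constraint_graph[of \<phi>'] fin(2) card_insert_le_m1[of "Suc (card \<phi>)" \<phi> c]
    by (simp add: \<phi>'_def)
  define L where "L = n * log 2 n"
  have "0 \<le> L" using n by (simp add: L_def n_def)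
  have nL: "n \<le> L + 1" unfolding L_def n_def by (rule le_nlogn)
  have upd_time: "real (case result r1 of UNSAT \<Rightarrow> 1 | Answer (G', \<pi>') \<Rightarrow> time (scst_update G' \<pi>' (pick c) \<rho> P))
     \<le> 50 * n + 12 * (L + 1) + 28 * m + 2 * p + 56"
  proof (cases "result r1 = UNSAT")
    case False
    then obtain G' \<pi>' where r1: "result r1 = Answer (G', \<pi>')" using answer_cases[of "result r1"] by blast
    have "time (scst_update G' \<pi>' (pick c) \<rho> P) \<le>
        25 * ?V + 2 * ?V * ceillog2 ?V + 14 * ?M + 2 * length P + 28"
      using cost_scst_update(1)[OF update(1,2)[OF r1], of "pick c" \<rho> P] m' card_vertices[OF fin(1)] by simp
    then have "real (time (scst_update G' \<pi>' (pick c) \<rho> P)) \<le>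
        real (25 * ?V + 2 * ?V * ceillog2 ?V + 14 * ?M + 2 * length P + 28)"
      unfolding of_nat_le_iff .
    also have "\<dots> = 50 * n + 2 * (real ?V * ceillog2 ?V) + 28 * m + 2 * p + 56"
      by (simp add: n_def m_def p_def V)
    also have "\<dots> \<le> 50 * n + 12 * (L + 1) + 28 * m + 2 * p + 56"
      using double_nlogn(2)[OF n] by (simp add: L_def n_def)
    finally show ?thesis using r1 by simp
  qed (use \<open>0 \<le> L\<close> in \<open>simp add: n_def m_def p_def\<close>)
  have upd_space: "real (case result r1 of UNSAT \<Rightarrow> 0 | Answer (G', \<pi>') \<Rightarrow> space (scst_update G' \<pi>' (pick c) \<rho> P))
     \<le> 18 * n + 10 * m + p + 10"
  proof (cases "result r1 = UNSAT")
    case False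
    then obtain G' \<pi>' where r1: "result r1 = Answer (G', \<pi>')" using answer_cases[of "result r1"] by blast
    have "space (scst_update G' \<pi>' (pick c) \<rho> P) \<le> 9 * ?V + 5 * ?M + length P"
      using cost_scst_update(2)[OF update(1,2)[OF r1], of "pick c" \<rho> P] m' card_vertices[OF fin(1)] by simp
    then have "real (space (scst_update G' \<pi>' (pick c) \<rho> P)) \<le> real (9 * ?V + 5 * ?M + length P)"
      unfolding of_nat_le_iff .
    also have "\<dots> = 18 * n + 10 * m + p + 10"
      by (simp add: n_def m_def p_def V)
    finally show ?thesis using r1 by simp
  qed (simp add: n_def m_def p_def)
  define t where "t = K * (real (card (vertices X)) * log 2 (real (card (vertices X))) + real ?M + 1)"
  define s where "s = K * (real (card (vertices X)) + real ?M + 1)"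
  \<comment> \<open>The 7 covers 4 from \<open>double_nlogn\<close> and the 3 left by
    \<open>?M\<close> plus one; at most two calls of the subroutine turn it into the 14 of the final
    constants.\<close>
  have t: "0 \<le> t" "t \<le> K * (7 * (L + m + p + 1))"
  proof -
    show "0 \<le> t" unfolding t_def card_vertices[OF fin(1)] using K n by simp
    show "t \<le> K * (7 * (L + m + p + 1))"
      unfolding t_def using K double_nlogn(1)[OF n] \<open>0 \<le> L\<close>
      by (intro mult_left_mono) (simp_all add: card_vertices[OF fin(1)] L_def n_def m_def p_def)
  qed
  have s: "0 \<le> s" "s \<le> K * (7 * (n + m + p))"
  proof -
    show "0 \<le> s" unfolding s_def using K by simp
    show "s \<le> K * (7 * (n + m + p))"
      unfolding s_def using K n
      by (intro mult_left_mono) (simp_all add: card_vertices[OF fin(1)] n_def m_def p_def)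
  qed
  have add_time: "time r1 \<le> 1 + 2 * (2 + t)"
  proof -
    have "time r1 \<le> 1 + length (order c) * (2 + t)" using add unfolding t_def by blast
    also have "\<dots> \<le> 1 + 2 * (2 + t)" using len t(1) by (intro add_left_mono mult_right_mono) auto
    finally show ?thesis .
  qed
  have add_space: "space r1 \<le> 2 * s"
  proof -
    have "space r1 \<le> length (order c) * s" using add unfolding s_def by blast
    also have "\<dots> \<le> 2 * s" using len s(1) by (intro mult_right_mono) auto
    finally show ?thesis .
  qed
  have time_r: "time r = time r1 + (case result r1 of UNSAT \<Rightarrow> 1
      | Answer (G', \<pi>') \<Rightarrow> time (scst_update G' \<pi>' (pick c) \<rho> P))"
    by (simp add: r_def scst_unfold r1_def split: answer.split)
  have space_r: "space r = 3 * length (fst G) + length (snd G) + length P + space r1 +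
      (case result r1 of UNSAT \<Rightarrow> 0 | Answer (G', \<pi>') \<Rightarrow> space (scst_update G' \<pi>' (pick c) \<rho> P))"
    by (simp add: r_def scst_unfold r1_def split: answer.split)
  have pos: "0 \<le> m" "0 \<le> p" "1 \<le> n" using n by (simp_all add: m_def p_def n_def)
  have "real (time r) \<le> 1 + 2 * (2 + t) + (50 * n + 12 * (L + 1) + 28 * m + 2 * p + 56)"
    using add_time upd_time by (simp add: time_r)
  also have "\<dots> \<le> 1 + 2 * (2 + K * (7 * (L + m + p + 1))) + (50 * (L + 1) + 12 * (L + 1) + 28 * m + 2 * p + 56)"
    using t nL by simp
  also have "\<dots> \<le> (150 + 14 * K) * (L + m + p + 1)"
    using pos \<open>0 \<le> L\<close> by (simp add: algebra_simps)
  finally show "time r \<le> (150 + 14 * K) * (n * log 2 n + m + p + 1)" by (simp add: L_def)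
  have "real (space r) \<le> 3 * (2 * n) + (2 * m + 2) + p + 2 * s + (18 * n + 10 * m + p + 10)"
  proof -
    have "real (space r) = 3 * real (length (fst G)) + real (length (snd G)) + real (length P) + real (space r1) +
      real (case result r1 of UNSAT \<Rightarrow> 0 | Answer (G', \<pi>') \<Rightarrow> space (scst_update G' \<pi>' (pick c) \<rho> P))"
      unfolding space_r by simp
    moreover have "real (length (snd G)) \<le> 2 * m + 2" using V(2) by (simp add: m_def)
    moreover have "real (length (fst G)) = 2 * n" "real (length P) = p" using V by (simp_all add: n_def p_def)
    ultimately show ?thesis using add_space upd_space by linarith
  qed
  \<comment> \<open>The constants 2 and 10 are replaced by \<open>2 * n\<close> and
    \<open>10 * n\<close>.\<close>
  also have "\<dots> \<le> 3 * (2 * n) + (2 * m + 2 * n) + p + 2 * (K * (7 * (n + m + p))) + (18 * n + 10 * m + p + 10 * n)"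
    using s pos by simp
  also have "\<dots> \<le> (50 + 14 * K) * (n + m + p)"
    using pos by (simp add: algebra_simps)
  finally show "space r \<le> (50 + 14 * K) * (n + m + p)" .
qed

theorem theorem5:
  fixes inc :: "'v vertex inc_alg"
  assumes "inc_con_diff inc"
  shows "\<exists>K::real. \<forall>(X :: 'v set) \<phi> G \<pi> \<rho> P Ps c order pick.
    finite X \<and> finite \<phi> \<and> finite P \<and>
    (\<forall>c'\<in>\<phi> \<union> P \<union> {c}. vars c' \<subseteq> X) \<and>
    satisfiable \<phi> \<and>
    represents G (vertices X) (constraint_graph \<phi>) \<and>
    valid_potential (constraint_graph \<phi>) \<pi> \<and>
    (\<forall>u\<in>vertices X. \<rho> u = bounds \<phi> u) \<and>
    distinct Ps \<and> set Ps = P \<and> (\<forall>c'\<in>P. \<not> entails \<phi> c') \<and>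
    distinct (order c) \<and> set (order c) = set (edges_of c) \<and> pick c \<in> set (edges_of c)
    \<longrightarrow>
    (let r = scst inc order pick G \<pi> \<rho> Ps c;
         \<phi>' = insert c \<phi>;
         n = real (card X); m = real (card \<phi>); p = real (card P)
     in (\<not> satisfiable \<phi>' \<longrightarrow> result r = UNSAT) \<and>
        (satisfiable \<phi>' \<longrightarrow> (\<exists>G' \<pi>' \<rho>' Ps'.
           result r = Answer (G', \<pi>', \<rho>', Ps') \<and>
           represents G' (vertices X) (constraint_graph \<phi>') \<and>
           valid_potential (constraint_graph \<phi>') \<pi>' \<and>
           (\<forall>u\<in>vertices X. \<rho>' u = bounds \<phi>' u) \<and>
           distinct Ps' \<and> set Ps' = {c'\<in>P. \<not> entails \<phi>' c'})) \<and>
        time r \<le> K * (n * log 2 n + m + p + 1) \<and>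
        space r \<le> K * (n + m + p))"
proof -
  obtain K where "inc_con_diff_with K inc"
    using assms by (auto simp: inc_con_diff_iff)
  \<comment> \<open>The final constant depends on \<open>inc\<close> alone and is fixed before the
    input; the smaller space constant is raised to the one for time.\<close>
  then have K: "inc_con_diff_with (max K 0) inc" by (rule inc_con_diff_with_mono) simp
  let ?K = "150 + 14 * max K 0"
  note scst = scst_correct_and_efficient[OF K max.cobounded2]
  have le: "(50 + 14 * max K 0) * (real a + real b + real e) \<le> ?K * (real a + real b + real e)" for a b e
    by (intro mult_right_mono) auto
  show ?thesis
  proof (intro exI[of _ ?K] allI impI, elim conjE)
    fix X :: "'v set" and \<phi> G \<pi> \<rho> P Ps c order pick
    assume fin: "finite X" "finite \<phi>" and vars: "\<forall>c'\<in>\<phi> \<union> P \<union> {c}. vars c' \<subseteq> X"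
      and G: "represents G (vertices X) (constraint_graph \<phi>)" "valid_potential (constraint_graph \<phi>) \<pi>"
      and \<rho>: "\<forall>u\<in>vertices X. \<rho> u = bounds \<phi> u"
      and P: "distinct Ps" "set Ps = P" "\<forall>c'\<in>P. \<not> entails \<phi> c'"
      and c: "distinct (order c)" "set (order c) = set (edges_of c)" "pick c \<in> set (edges_of c)"
    note scst = scst_correct_and_efficient[where order=order and c=c and pick=pick and \<rho>=\<rho>,
        OF K max.cobounded2 fin vars[folded P(2)] G \<rho> P(1) P(3)[folded P(2)] c]
    show "let r = scst inc order pick G \<pi> \<rho> Ps c;
         \<phi>' = insert c \<phi>;
         n = real (card X); m = real (card \<phi>); p = real (card P)
     in (\<not> satisfiable \<phi>' \<longrightarrow> result r = UNSAT) \<and>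
        (satisfiable \<phi>' \<longrightarrow> (\<exists>G' \<pi>' \<rho>' Ps'.
           result r = Answer (G', \<pi>', \<rho>', Ps') \<and>
           represents G' (vertices X) (constraint_graph \<phi>') \<and>
           valid_potential (constraint_graph \<phi>') \<pi>' \<and>
           (\<forall>u\<in>vertices X. \<rho>' u = bounds \<phi>' u) \<and>
           distinct Ps' \<and> set Ps' = {c'\<in>P. \<not> entails \<phi>' c'})) \<and>
        time r \<le> ?K * (n * log 2 n + m + p + 1) \<and>
        space r \<le> ?K * (n + m + p)"
      unfolding Let_def P(2)[symmetric]
    proof (intro conjI impI)
      show "result (scst inc order pick G \<pi> \<rho> Ps c) = UNSAT" if "\<not> satisfiable (insert c \<phi>)"
        using that by (rule scst(1))
      show "\<exists>G' \<pi>' \<rho>' Ps'. result (scst inc order pick G \<pi> \<rho> Ps c) = Answer (G', \<pi>', \<rho>', Ps') \<and>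
           represents G' (vertices X) (constraint_graph (insert c \<phi>)) \<and>
           valid_potential (constraint_graph (insert c \<phi>)) \<pi>' \<and>
           (\<forall>u\<in>vertices X. \<rho>' u = bounds (insert c \<phi>) u) \<and>
           distinct Ps' \<and> set Ps' = {c'\<in>set Ps. \<not> entails (insert c \<phi>) c'}"
        if "satisfiable (insert c \<phi>)"
        using that by (rule scst(2))
      show "time (scst inc order pick G \<pi> \<rho> Ps c) \<le>
          ?K * (real (card X) * log 2 (real (card X)) + real (card \<phi>) + real (card (set Ps)) + 1)"
        by (rule scst(3))
      show "space (scst inc order pick G \<pi> \<rho> Ps c) \<le>
          ?K * (real (card X) + real (card \<phi>) + real (card (set Ps)))"
        by (rule order_trans[OF scst(4) le])
    qed
  qed
qed

end
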